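(* Let $m,n$ be positive integers with $n\ge 15$, $m\ge 9$, $m-1\nmid n-5$ and $n>m+1+\frac{12}{m-8}$. Let $T_m^0\in\{T_m^*,T_m^1,T_m^2\}$ and $T_n\in\{T_n'',T_n''',T_n^3\}$. Then $r(T_m^0,T_n)\in\{m+n-7,\,m+n-6\}$. Moreover, if $n\ge (m-3)^2+4$, or if $m+n-7=(m-1)x+(m-2)y$ for some nonnegative integers $x,y$, then $r(T_m^0,T_n)=m+n-6$.
   Context: All graphs are finite simple graphs. For graphs $G_1,G_2$, the Ramsey number $r(G_1,G_2)$ is the smallest positive integer $N$ such that for every graph $G$ on $N$ vertices, either $G$ contains a (not necessarily induced) subgraph isomorphic to $G_1$, or the complement $\overline{G}$ contains a subgraph isomorphic to $G_2$. For a tree on $k$ vertices take vertex set $\{v_0,\ldots,v_{k-1}\}$. $T_k^*$: edges $v_0v_1,\ldots,v_0v_{k-3},v_{k-3}v_{k-2},v_{k-2}v_{k-1}$. $T_k^1$: edges $v_0v_1,\ldots,v_0v_{k-3},v_{k-4}v_{k-2},v_{k-3}v_{k-1}$. $T_k^2$: edges $v_0v_1,\ldots,v_0v_{k-3},v_{k-3}v_{k-2},v_{k-3}v_{k-1}$. $T_k^3$: edges $v_0v_1,\ldots,v_0v_{k-4},v_{k-4}v_{k-3},v_{k-4}v_{k-2},v_{k-4}v_{k-1}$. $T_k''$: edges $v_0v_1,\ldots,v_0v_{k-4},v_1v_{k-3},v_1v_{k-2},v_2v_{k-1}$. $T_k'''$: edges $v_0v_1,\ldots,v_0v_{k-4},v_1v_{k-3},v_2v_{k-2},v_3v_{k-1}$.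 *)

theory Defs
  imports Complex_Main "HOL-Library.Ramsey"
begin

text \<open>A graph is a pair (vertex set, edge set); an edge is a two-element set of vertices.\<close>

type_synonym 'a graph = "'a set \<times> 'a set set"

abbreviation verts :: "'a graph \<Rightarrow> 'a set" where
  "verts G \<equiv> fst G"

abbreviation edges :: "'a graph \<Rightarrow> 'a set set" where
  "edges G \<equiv> snd G"

definition simple_graph :: "'a graph \<Rightarrow> bool" where
  "simple_graph G \<longleftrightarrow> finite (verts G) \<and> edges G \<subseteq> nsets (verts G) 2"

definition graph_complement :: "'a graph \<Rightarrow> 'a graph" where
  "graph_complement G = (verts G, nsets (verts G) 2 - edges G)"

definition subgraph :: "'a graph \<Rightarrow> 'a graph \<Rightarrow> bool" where
  "subgraph H G \<longleftrightarrow> simple_graph H \<and> verts H \<subseteq> verts G \<and> edges H \<subseteq> edges G"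

definition graph_iso :: "'a graph \<Rightarrow> 'b graph \<Rightarrow> bool" where
  "graph_iso G H \<longleftrightarrow>
     (\<exists>f. bij_betw f (verts G) (verts H) \<and>
          (\<forall>u\<in>verts G. \<forall>v\<in>verts G. {u, v} \<in> edges G \<longleftrightarrow> {f u, f v} \<in> edges H))"

definition contains_copy :: "'a graph \<Rightarrow> 'b graph \<Rightarrow> bool" where
  "contains_copy G H \<longleftrightarrow> (\<exists>H'. subgraph H' G \<and> graph_iso H' H)"

text \<open>The host graphs have vertices in \<^typ>\<open>nat\<close>; this loses nothing, since every finite
  graph is isomorphic to one of these. The minimum exists for all finite simple graphs
  by Ramsey's theorem.\<close>

definition ramsey_number :: "'a graph \<Rightarrow> 'b graph \<Rightarrow> nat" where
  "ramsey_number G1 G2 =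
     (LEAST N. N > 0 \<and>
        (\<forall>G :: nat graph. simple_graph G \<and> card (verts G) = N \<longrightarrow>
           contains_copy G G1 \<or> contains_copy (graph_complement G) G2))"

text \<open>In the trees below the number \<open>i\<close> stands for the vertex \<open>v\<^sub>i\<close>. For \<open>k \<ge> 7\<close>
  no subtraction is truncated and each of them is a tree on \<open>k\<close> vertices.\<close>

definition T_star :: "nat \<Rightarrow> nat graph" where
  "T_star k = ({0..<k}, (\<lambda>i. {0, i}) ` {1..k-3} \<union> {{k-3, k-2}, {k-2, k-1}})"

definition T_one :: "nat \<Rightarrow> nat graph" where
  "T_one k = ({0..<k}, (\<lambda>i. {0, i}) ` {1..k-3} \<union> {{k-4, k-2}, {k-3, k-1}})"

definition T_two :: "nat \<Rightarrow> nat graph" where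
  "T_two k = ({0..<k}, (\<lambda>i. {0, i}) ` {1..k-3} \<union> {{k-3, k-2}, {k-3, k-1}})"

definition T_three :: "nat \<Rightarrow> nat graph" where
  "T_three k =
     ({0..<k}, (\<lambda>i. {0, i}) ` {1..k-4} \<union> {{k-4, k-3}, {k-4, k-2}, {k-4, k-1}})"

definition T_dprime :: "nat \<Rightarrow> nat graph" where
  "T_dprime k =
     ({0..<k}, (\<lambda>i. {0, i}) ` {1..k-4} \<union> {{1, k-3}, {1, k-2}, {2, k-1}})"

definition T_tprime :: "nat \<Rightarrow> nat graph" where
  "T_tprime k =
     ({0..<k}, (\<lambda>i. {0, i}) ` {1..k-4} \<union> {{1, k-3}, {2, k-2}, {3, k-1}})"

end

theory Submission
  imports Defs
begin

text \<open>
  Upper bound: let \<open>G\<close> have \<open>m + n - 6\<close> vertices and complement \<open>H\<close>. If \<open>H\<close> has maximum degree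
  at most \<open>n - 5\<close>, then \<open>G\<close> has minimum degree at least \<open>m - 2\<close>; without a copy of the smaller
  tree all its components are complete graphs on \<open>m - 1\<close> vertices, so \<open>m - 1\<close> divides
  \<open>m + n - 6\<close> and hence \<open>n - 5\<close>. Otherwise take a vertex \<open>v\<close> of maximum degree in \<open>H\<close> and let
  \<open>A\<close> and \<open>B\<close> be its neighbourhoods in \<open>H\<close> and \<open>G\<close>. If \<open>H\<close> does not contain the larger tree with
  centre \<open>v\<close>, then few edges of \<open>H\<close> leave the vertices of \<open>A\<close>. When \<open>A\<close> has at most \<open>n - 2\<close>
  vertices, this makes \<open>G\<close> almost complete bipartite between \<open>A\<close> and \<open>B\<close>, and the smaller tree
  has a copy with centre in \<open>B\<close> that passes through \<open>v\<close>; when \<open>A\<close> is larger, \<open>G\<close> is almost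
  complete on \<open>A\<close>.

  Lower bounds: use an \<open>(m - 4)\<close>-regular graph on \<open>m + n - 8\<close> vertices (for odd \<open>m\<close> and even \<open>n\<close>,
  where it does not exist, a complete graph on \<open>m - 2\<close> vertices and an \<open>(m - 4)\<close>-regular graph on
  the rest), and disjoint complete graphs on \<open>m - 1\<close> and \<open>m - 2\<close> vertices in total \<open>m + n - 7\<close>.
  Such complete graphs exist as soon as \<open>m + n - 7 \<ge> (m - 2) (m - 3)\<close>.
\<close>

section \<open>Neighbourhoods and copies\<close>

definition nbh :: "'a graph \<Rightarrow> 'a \<Rightarrow> 'a set" where
  "nbh G v = {u. {v, u} \<in> edges G}"

lemma nbh_sym: "u \<in> nbh G v \<longleftrightarrow> v \<in> nbh G u"
  by (simp add: nbh_def insert_commute)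

lemma nbh_verts:
  assumes "simple_graph G" "u \<in> nbh G v"
  shows "u \<in> verts G" "v \<in> verts G" "u \<noteq> v"
proof -
  have "{v, u} \<in> nsets (verts G) 2"
    using assms unfolding simple_graph_def nbh_def by blast
  then show "u \<in> verts G" "v \<in> verts G" "u \<noteq> v"
    by auto
qed

lemma nbh_irrefl: "simple_graph G \<Longrightarrow> v \<notin> nbh G v"
  by (metis nbh_verts(3))

lemma finite_nbh: "simple_graph G \<Longrightarrow> finite (nbh G v)"
  by (rule finite_subset[of _ "verts G"]) (auto intro: nbh_verts(1) simp: simple_graph_def)

lemma simple_graph_complement: "simple_graph G \<Longrightarrow> simple_graph (graph_complement G)"
  by (auto simp: simple_graph_def graph_complement_def)

lemma nbh_complement:
  assumes "v \<in> verts G"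
  shows "nbh (graph_complement G) v = verts G - {v} - nbh G v"
  using assms by (auto simp: nbh_def graph_complement_def)

lemma card_nbh_complement:
  assumes "simple_graph G" "v \<in> verts G"
  shows "card (nbh (graph_complement G) v) + card (nbh G v) + 1 = card (verts G)"
proof -
  have fin: "finite (verts G)"
    using assms by (simp add: simple_graph_def)
  have "verts G = insert v (nbh (graph_complement G) v \<union> nbh G v)"
    using assms by (auto simp: nbh_complement nbh_verts)
  moreover have "v \<notin> nbh (graph_complement G) v \<union> nbh G v"
    "nbh (graph_complement G) v \<inter> nbh G v = {}"
    using assms by (auto simp: nbh_complement nbh_irrefl)
  moreover have "finite (nbh (graph_complement G) v)" "finite (nbh G v)"
    using assms fin by (auto simp: nbh_complement finite_nbh)
  ultimately show ?thesis
    by (simp add: card_Un_disjoint)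
qed

text \<open>Only images of vertices and edges of \<open>T\<close> enter the copy, so the equivalence
  in \<open>graph_iso\<close> holds even if \<open>G\<close> has further edges among these
  vertices.\<close>

lemma contains_copyI:
  assumes T: "simple_graph T" and f: "inj_on f (verts T)" "f ` verts T \<subseteq> verts G"
    and e: "\<And>e. e \<in> edges T \<Longrightarrow> f ` e \<in> edges G"
  shows "contains_copy G T"
proof -
  let ?H = "(f ` verts T, image f ` edges T)"
  have sub: "e \<subseteq> verts T" "card e = 2" "finite e" if "e \<in> edges T" for e
  proof -
    have "e \<in> nsets (verts T) 2"
      using T that unfolding simple_graph_def by blast
    then show "e \<subseteq> verts T" "card e = 2" "finite e"
      by (simp_all add: nsets_def)
  qed
  have "f ` e \<in> nsets (f ` verts T) 2" if "e \<in> edges T" for e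
    using sub[OF that] card_image[OF inj_on_subset[OF f(1)], of e]
    by (simp add: nsets_def image_mono)
  then have "image f ` edges T \<subseteq> nsets (f ` verts T) 2"
    by blast
  moreover have "image f ` edges T \<subseteq> edges G"
    using e by blast
  ultimately have "subgraph ?H G"
    using T f(2) by (simp add: subgraph_def simple_graph_def)
  moreover have "graph_iso ?H T"
    unfolding graph_iso_def
  proof (intro exI conjI ballI)
    let ?g = "inv_into (verts T) f"
    show "bij_betw ?g (verts ?H) (verts T)"
      using f(1) by (simp add: bij_betw_inv_into inj_on_imp_bij_betw)
    fix u v assume "u \<in> verts ?H" "v \<in> verts ?H"
    then obtain i j where ij: "i \<in> verts T" "j \<in> verts T" "u = f i" "v = f j"
      by auto
    have "f ` {i, j} \<in> image f ` edges T \<longleftrightarrow> {i, j} \<in> edges T"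
    proof
      assume "f ` {i, j} \<in> image f ` edges T"
      then obtain e where e: "e \<in> edges T" "f ` {i, j} = f ` e"
        by auto
      then have "{i, j} = e"
        using ij sub(1)[OF e(1)] inj_on_image_eq_iff[OF f(1), of "{i, j}" e] by blast
      then show "{i, j} \<in> edges T"
        using e by simp
    qed blast
    then show "{u, v} \<in> edges ?H \<longleftrightarrow> {?g u, ?g v} \<in> edges T"
      using ij f(1) by simp
  qed
  ultimately show ?thesis
    unfolding contains_copy_def by blast
qed

lemma contains_copyE:
  assumes "contains_copy G T"
  obtains f where "inj_on f (verts T)" "f ` verts T \<subseteq> verts G"
    "\<And>i j. i \<in> verts T \<Longrightarrow> j \<in> verts T \<Longrightarrow> {i, j} \<in> edges T \<Longrightarrow> f j \<in> nbh G (f i)"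
proof -
  obtain H g where H: "subgraph H G" and g: "bij_betw g (verts H) (verts T)"
    and e: "\<And>u v. u \<in> verts H \<Longrightarrow> v \<in> verts H \<Longrightarrow> {u, v} \<in> edges H \<longleftrightarrow> {g u, g v} \<in> edges T"
    using assms unfolding contains_copy_def graph_iso_def by blast
  define f where "f = inv_into (verts H) g"
  have f: "bij_betw f (verts T) (verts H)"
    unfolding f_def by (rule bij_betw_inv_into[OF g])
  have fg: "g (f i) = i" "f i \<in> verts H" if "i \<in> verts T" for i
    using that g f by (auto simp: f_def bij_betw_def f_inv_into_f inv_into_into)
  have "f j \<in> nbh G (f i)" if "i \<in> verts T" "j \<in> verts T" "{i, j} \<in> edges T" for i j
    using e[of "f i" "f j"] that fg H by (auto simp: nbh_def subgraph_def)
  then show thesis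
    using that[of f] f H by (auto simp: bij_betw_def subgraph_def)
qed

text \<open>Each of the six trees is a star around 0 plus a few extra edges \<open>F\<close>. The
  list spells out the embedding: position \<open>i\<close> holds the image of vertex
  \<open>i\<close>, and \<open>ys\<close> are the vertices outside the star.\<close>

lemma contains_copy_nth:
  assumes simple: "simple_graph ({0..<k}, (\<lambda>i. {0, i}) ` {1..t} \<union> F)"
    and ls: "distinct (c # ms @ ys)" "1 + length ms + length ys = k" "length ms = t"
    and G: "c \<in> verts G" "set ms \<subseteq> verts G \<inter> nbh G c" "set ys \<subseteq> verts G"
    and F: "\<And>e. e \<in> F \<Longrightarrow> (!) (c # ms @ ys) ` e \<in> edges G"
  shows "contains_copy G ({0..<k}, (\<lambda>i. {0, i}) ` {1..t} \<union> F)"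
proof (rule contains_copyI[OF simple, where f = "(!) (c # ms @ ys)"])
  let ?ls = "c # ms @ ys"
  show "inj_on ((!) ?ls) (verts ({0..<k}, (\<lambda>i. {0, i}) ` {1..t} \<union> F))"
    using ls by (intro inj_on_nth) auto
  have "set ?ls \<subseteq> verts G"
    using G by auto
  then have "?ls ! i \<in> verts G" if "i < length ?ls" for i
    using nth_mem[OF that] by blast
  then show "(!) ?ls ` verts ({0..<k}, (\<lambda>i. {0, i}) ` {1..t} \<union> F) \<subseteq> verts G"
    using ls by auto
  fix e assume "e \<in> edges ({0..<k}, (\<lambda>i. {0, i}) ` {1..t} \<union> F)"
  then consider i where "1 \<le> i" "i \<le> t" "e = {0, i}" | "e \<in> F"
    by auto
  then show "(!) ?ls ` e \<in> edges G"
  proof cases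
    case 1
    then obtain i' where i': "i = Suc i'" "i' < length ms"
      using ls(3) by (cases i) auto
    then have "?ls ! i = ms ! (i - 1)"
      by (simp add: nth_append)
    moreover have "ms ! (i - 1) \<in> nbh G c"
      using i' G(2) nth_mem[of i' ms] by auto
    ultimately show ?thesis
      using 1 by (simp add: nbh_def)
  qed (rule F)
qed

lemma obtain_list_of_length:
  assumes "k \<le> card L"
  obtains rs where "distinct rs" "set rs \<subseteq> L" "length rs = k"
proof -
  obtain S where "S \<subseteq> L" "card S = k" "finite S"
    using obtain_subset_with_card_n[OF assms] by metis
  then show thesis
    using that finite_distinct_list[of S] distinct_card by metis
qed

section \<open>Graphs witnessing the lower bounds\<close>

text \<open>A vertex of degree at least \<^term>\<open>d\<close> has small degree in the complement. Such a vertex is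
  excluded as the centre of the smaller tree either by its degree or by the size of its component.\<close>

definition admissible :: "nat \<Rightarrow> nat \<Rightarrow> (nat \<Rightarrow> nat \<Rightarrow> bool) \<Rightarrow> nat \<Rightarrow> bool" where
  "admissible m d E i \<longleftrightarrow> d \<le> card {j. E i j} \<and> (card {j. E i j} \<le> m - 4 \<or>
     (\<exists>C. i \<in> C \<and> finite C \<and> card C \<le> m - 1 \<and> (\<forall>u\<in>C. {j. E u j} \<subseteq> C)))"

text \<open>The vertices form an initial segment of the naturals, so that a disjoint union is a
  shift of one relation by \<open>p\<close>.\<close>

definition realizable :: "nat \<Rightarrow> nat \<Rightarrow> nat \<Rightarrow> bool" where
  "realizable m d p \<longleftrightarrow> (\<exists>E. (\<forall>i j. E i j \<longrightarrow> i < p \<and> j < p \<and> i \<noteq> j \<and> E j i) \<and>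
     (\<forall>i<p. admissible m d E i))"

lemma realizable_0: "realizable m d 0"
  unfolding realizable_def by (rule exI[of _ "\<lambda>_ _. False"]) simp

lemma realizable_clique:
  assumes "d + 1 \<le> p" "p \<le> m - 1"
  shows "realizable m d p"
proof -
  let ?E = "\<lambda>i j. i < p \<and> j < p \<and> i \<noteq> j"
  have "admissible m d ?E i" if i: "i < p" for i
  proof -
    have "{j. ?E i j} = {0..<p} - {i}"
      using i by auto
    then have "d \<le> card {j. ?E i j}"
      using assms i by simp
    moreover have "i \<in> {0..<p} \<and> finite {0..<p} \<and> card {0..<p} \<le> m - 1 \<and>
        (\<forall>u\<in>{0..<p}. {j. ?E u j} \<subseteq> {0..<p})"
      using assms i by auto
    ultimately show ?thesis
      unfolding admissible_def by blast
  qed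
  then show ?thesis
    unfolding realizable_def by (intro exI[of _ ?E]) simp
qed

lemma admissible_extend:
  assumes adm: "admissible m d E1 i" and i: "i < p"
    and E: "\<And>u. u < p \<Longrightarrow> {j. E u j} = {j. E1 u j}" and E1: "\<And>u. {j. E1 u j} \<subseteq> {..<p}"
  shows "admissible m d E i"
proof (cases "card {j. E1 i j} \<le> m - 4")
  case True
  then show ?thesis
    using adm by (simp add: admissible_def E[OF i])
next
  case False
  then obtain C where C: "i \<in> C" "finite C" "card C \<le> m - 1" "\<forall>u\<in>C. {j. E1 u j} \<subseteq> C"
    using adm unfolding admissible_def by blast
  \<comment> \<open>\<open>C\<close> may contain indices from \<open>p\<close> on, where
    \<open>E\<close> can have edges that \<open>E1\<close> lacks; only the part below
    \<open>p\<close> is sure to stay closed.\<close>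
  have "card (C \<inter> {..<p}) \<le> m - 1"
    using C(2,3) card_mono[of C "C \<inter> {..<p}"] by simp
  moreover have "{j. E u j} \<subseteq> C \<inter> {..<p}" if "u \<in> C \<inter> {..<p}" for u
    using that C(4) E[of u] E1[of u] by simp
  ultimately show ?thesis
    unfolding admissible_def using adm C(1,2) i E[OF i]
    by (intro conjI disjI2 exI[of _ "C \<inter> {..<p}"]) (simp_all add: admissible_def)
qed

lemma admissible_shift:
  assumes adm: "admissible m d E2 i" and E: "\<And>u. {j. E (p + u) j} = (+) p ` {j. E2 u j}"
  shows "admissible m d E (p + i)"
proof -
  have card: "card {j. E (p + i) j} = card {j. E2 i j}"
    unfolding E by (simp add: card_image)
  show ?thesis
  proof (cases "card {j. E2 i j} \<le> m - 4")
    case True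
    then show ?thesis
      using adm by (simp add: admissible_def card)
  next
    case False
    then obtain C where C: "i \<in> C" "finite C" "card C \<le> m - 1" "\<forall>u\<in>C. {j. E2 u j} \<subseteq> C"
      using adm unfolding admissible_def by blast
    have "card ((+) p ` C) \<le> m - 1"
      using C(3) by (simp add: card_image)
    moreover have "{j. E u j} \<subseteq> (+) p ` C" if u: "u \<in> (+) p ` C" for u
    proof -
      obtain u' where "u = p + u'" "u' \<in> C"
        using u by blast
      then show ?thesis
        using C(4) by (simp add: E image_mono)
    qed
    ultimately show ?thesis
      unfolding admissible_def using adm C(1,2) card
      by (intro conjI disjI2 exI[of _ "(+) p ` C"]) (simp_all add: admissible_def)
  qed
qed

lemma realizable_add:
  assumes "realizable m d p" "realizable m d q"
  shows "realizable m d (p + q)"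
proof -
  obtain E1 where E1: "\<And>i j. E1 i j \<Longrightarrow> i < p \<and> j < p \<and> i \<noteq> j \<and> E1 j i"
    and D1: "\<And>i. i < p \<Longrightarrow> admissible m d E1 i"
    using assms(1) unfolding realizable_def by blast
  obtain E2 where E2: "\<And>i j. E2 i j \<Longrightarrow> i < q \<and> j < q \<and> i \<noteq> j \<and> E2 j i"
    and D2: "\<And>i. i < q \<Longrightarrow> admissible m d E2 i"
    using assms(2) unfolding realizable_def by blast
  define E where "E i j \<longleftrightarrow> E1 i j \<or> (p \<le> i \<and> p \<le> j \<and> E2 (i - p) (j - p))" for i j
  have nb1: "{j. E i j} = {j. E1 i j}" if "i < p" for i
    using that by (simp add: E_def)
  have nb2: "{j. E (p + i) j} = (+) p ` {j. E2 i j}" for i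
  proof (intro equalityI subsetI)
    fix j assume "j \<in> {j. E (p + i) j}"
    then have "p \<le> j" "E2 i (j - p)"
      using E1[of "p + i" j] by (auto simp: E_def)
    then show "j \<in> (+) p ` {j. E2 i j}"
      by (intro image_eqI[of _ _ "j - p"]) simp_all
  qed (auto simp: E_def)
  have E: "i < p + q \<and> j < p + q \<and> i \<noteq> j \<and> E j i" if "E i j" for i j
  proof (cases "E1 i j")
    case True
    then show ?thesis
      using E1[OF True] by (simp add: E_def)
  next
    case False
    then have "p \<le> i" "p \<le> j" "E2 (i - p) (j - p)"
      using that by (simp_all add: E_def)
    then show ?thesis
      using E2[of "i - p" "j - p"] by (auto simp: E_def)
  qed
  have "admissible m d E i" if i: "i < p + q" for i
  proof (cases "i < p")
    case True
    have "{j. E1 u j} \<subseteq> {..<p}" for u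
      using E1[of u] by blast
    then show ?thesis
      using admissible_extend[OF D1[OF True] True nb1] by blast
  next
    case False
    then have "i = p + (i - p)" "i - p < q"
      using i by simp_all
    then show ?thesis
      using admissible_shift[OF D2 nb2, of "i - p"] by simp
  qed
  then show ?thesis
    unfolding realizable_def using E by blast
qed

lemma realizable_mult: "realizable m d p \<Longrightarrow> realizable m d (p * x)"
  by (induction x) (auto simp: realizable_0 realizable_add)

text \<open>\<open>S\<close> serves as connection set of a circulant graph. Differences come in
  pairs \<open>s\<close>, \<open>p - s\<close>; an odd size calls for one that is its own partner,
  half of \<open>p\<close>, and parity makes \<open>p\<close> even then.\<close>

lemma ex_symmetric_differences:
  assumes "d < p" "even (d * p)"
  shows "\<exists>S\<subseteq>{1..<p}. card S = d \<and> (\<forall>s\<in>S. p - s \<in> S)"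
proof (cases "even d")
  case True
  then obtain h where h: "d = 2 * h"
    by blast
  let ?S = "{1..h} \<union> {p - h..<p}"
  have hp: "h < p - h"
    using h assms(1) by simp
  then have "card ?S = d"
    using h by (subst card_Un_disjoint) auto
  moreover have "?S \<subseteq> {1..<p}"
    using hp by auto
  moreover have "p - s \<in> ?S" if "s \<in> ?S" for s
    using that hp unfolding Un_iff atLeastAtMost_iff atLeastLessThan_iff by linarith
  ultimately show ?thesis
    by blast
next
  case False
  then obtain h q where h: "d = 2 * h + 1" and q: "p = 2 * q"
    using assms(2) by (auto elim!: oddE evenE)
  let ?S = "insert q ({1..h} \<union> {p - h..<p})"
  have hq: "h < q"
    using h q assms(1) by simp
  then have "card ({1..h} \<union> {p - h..<p}) = 2 * h"
    using q by (subst card_Un_disjoint) auto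
  moreover have "q \<notin> {1..h} \<union> {p - h..<p}"
    using q hq by simp
  ultimately have "card ?S = d"
    using h by simp
  moreover have "?S \<subseteq> {1..<p}"
    using q hq by auto
  moreover have "p - s \<in> ?S" if "s \<in> ?S" for s
    using that q hq unfolding insert_iff Un_iff atLeastAtMost_iff atLeastLessThan_iff by linarith
  ultimately show ?thesis
    by blast
qed

text \<open>A circulant graph; the truncated subtractions encode \<open>\<bar>i - j\<bar>\<close>.\<close>

lemma realizable_regular:
  assumes "m - 4 < p" "even ((m - 4) * p)"
  shows "realizable m (m - 4) p"
proof -
  obtain S where S: "S \<subseteq> {1..<p}" "card S = m - 4" "\<And>s. s \<in> S \<Longrightarrow> p - s \<in> S"
    using ex_symmetric_differences[OF assms] by blast
  define E where "E i j \<longleftrightarrow> i < p \<and> j < p \<and> (i - j) + (j - i) \<in> S" for i j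
  have deg: "card {j. E i j} = m - 4" if i: "i < p" for i
  proof -
    \<comment> \<open>\<open>?f s\<close> is \<open>i - s\<close> modulo \<open>p\<close>.\<close>
    let ?f = "\<lambda>s. if s \<le> i then i - s else i + (p - s)"
    have "inj_on ?f S"
      using S(1) i by (intro inj_onI) (auto split: if_splits)
    moreover have "?f ` S = {j. E i j}"
    proof (intro equalityI subsetI)
      fix j assume "j \<in> ?f ` S"
      then obtain s where s: "s \<in> S" "j = ?f s"
        by blast
      moreover have "1 \<le> s" "s < p" "p - s \<in> S"
        using s S by auto
      ultimately show "j \<in> {j. E i j}"
        using i by (auto simp: E_def)
    next
      fix j assume "j \<in> {j. E i j}"
      then have j: "j < p" "(i - j) + (j - i) \<in> S"
        by (auto simp: E_def)
      show "j \<in> ?f ` S"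
      proof (cases "j \<le> i")
        case True
        then show ?thesis
          using j by (intro image_eqI[of _ _ "i - j"]) auto
      next
        case False
        then have "p - (j - i) \<in> S"
          using j S(3)[of "j - i"] by simp
        moreover have "j = ?f (p - (j - i))"
          using False j(1) i by simp
        ultimately show ?thesis
          by (rule rev_image_eqI)
      qed
    qed
    ultimately show ?thesis
      using S(2) card_image[of ?f S] by simp
  qed
  have "i < p \<and> j < p \<and> i \<noteq> j \<and> E j i" if "E i j" for i j
    using that S(1) by (auto simp: E_def add.commute)
  moreover have "admissible m (m - 4) E i" if "i < p" for i
    using deg[OF that] by (simp add: admissible_def)
  ultimately show ?thesis
    unfolding realizable_def by blast
qed

lemma realizable_near_regular:
  assumes m: "9 \<le> m" and mn: "m + 2 \<le> n"
  shows "realizable m (m - 4) (m + n - 8)"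
proof (cases "even ((m - 4) * (m + n - 8))")
  case True
  then show ?thesis
    using m mn by (intro realizable_regular) auto
next
  case False
  then have odd: "odd m" "even n"
    using m mn by auto
  \<comment> \<open>Parity gives \<open>n \<ge> m + 3\<close>, so the even number
    \<open>n - 6\<close> exceeds \<open>m - 4\<close> and a regular graph exists on that many
    vertices.\<close>
  then have "m + 2 \<noteq> n"
    by auto
  then have "realizable m (m - 4) (n - 6)"
    using m mn odd by (intro realizable_regular) auto
  moreover have "realizable m (m - 4) (m - 2)"
    by (rule realizable_clique) (use m in auto)
  ultimately have "realizable m (m - 4) ((m - 2) + (n - 6))"
    by (intro realizable_add)
  moreover have "(m - 2) + (n - 6) = m + n - 8"
    using m mn by simp
  ultimately show ?thesis
    by simp
qed

text \<open>Divide \<open>N\<close> by \<open>j + 1\<close>. The remainder is at most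
  \<open>j\<close>, hence at most the quotient, so it can be spread over the blocks of size
  \<open>j + 1\<close>, enlarging that many of them by one.\<close>

lemma ex_consecutive_combination:
  fixes j N :: nat
  assumes "j * (j + 1) \<le> N"
  shows "\<exists>x y. N = (j + 2) * x + (j + 1) * y"
proof -
  have q: "j \<le> N div (j + 1)"
    using assms less_eq_div_iff_mult_less_eq[of "j + 1" j N] by simp
  have r: "N mod (j + 1) \<le> j"
    using mod_less_divisor[of "j + 1" N] by simp
  have "N = (j + 1) * (N div (j + 1)) + N mod (j + 1)"
    by (rule mult_div_mod_eq[symmetric])
  moreover obtain t where t: "N div (j + 1) = N mod (j + 1) + t"
    using le_trans[OF r q] by (metis le_Suc_ex)
  ultimately have "N = (j + 1) * (N mod (j + 1) + t) + N mod (j + 1)"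
    by metis
  then have "N = (j + 2) * (N mod (j + 1)) + (j + 1) * t"
    by (simp add: algebra_simps)
  then show ?thesis
    by blast
qed

section \<open>Why the witnesses contain neither tree\<close>

lemma star_degree:
  assumes G: "simple_graph G" and T: "verts T = {0..<k}" "(\<lambda>i. {0, i}) ` {1..t} \<subseteq> edges T" "t < k"
    and f: "inj_on f (verts T)"
      "\<And>i j. i \<in> verts T \<Longrightarrow> j \<in> verts T \<Longrightarrow> {i, j} \<in> edges T \<Longrightarrow> f j \<in> nbh G (f i)"
  shows "f ` {1..t} \<subseteq> nbh G (f 0)" "t \<le> card (nbh G (f 0))"
proof -
  show *: "f ` {1..t} \<subseteq> nbh G (f 0)"
  proof (rule image_subsetI)
    fix i assume i: "i \<in> {1..t}"
    then have "{0, i} \<in> edges T"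
      using T(2) by blast
    then show "f i \<in> nbh G (f 0)"
      using f(2)[of 0 i] i T by auto
  qed
  have "inj_on f {1..t}"
    by (rule inj_on_subset[OF f(1)]) (use T in auto)
  then have "card (f ` {1..t}) = t"
    by (simp add: card_image)
  then show "t \<le> card (nbh G (f 0))"
    using card_mono[OF finite_nbh[OF G] *] by simp
qed

text \<open>The centre needs degree \<open>m - 3\<close>, which leaves only the second alternative
  of \<open>small\<close>. A set closed under adjacency that contains the centre contains the whole
  copy, but \<open>C\<close> is too small for \<open>m\<close> vertices.\<close>

lemma no_copy_if_small_components:
  assumes G: "simple_graph G" and m: "7 \<le> m" and T: "T \<in> {T_star m, T_one m, T_two m}"
    and small: "\<And>v. v \<in> verts G \<Longrightarrow> card (nbh G v) \<le> m - 4 \<or>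
      (\<exists>C. v \<in> C \<and> finite C \<and> card C \<le> m - 1 \<and> (\<forall>u\<in>C. nbh G u \<subseteq> C))"
  shows "\<not> contains_copy G T"
proof
  assume "contains_copy G T"
  then obtain f where f: "inj_on f (verts T)" "f ` verts T \<subseteq> verts G"
    "\<And>i j. i \<in> verts T \<Longrightarrow> j \<in> verts T \<Longrightarrow> {i, j} \<in> edges T \<Longrightarrow> f j \<in> nbh G (f i)"
    by (rule contains_copyE) (rule that)
  have V: "verts T = {0..<m}" and star: "(\<lambda>i. {0, i}) ` {1..m - 3} \<subseteq> edges T"
    using T by (auto simp: T_star_def T_one_def T_two_def)
  have nb: "f ` {1..m - 3} \<subseteq> nbh G (f 0)" "m - 3 \<le> card (nbh G (f 0))"
    using star_degree[OF G V star _ f(1,3)] m by auto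
  have "f 0 \<in> verts G" "\<not> card (nbh G (f 0)) \<le> m - 4"
    using nb(2) f(2) V m by auto
  then obtain C where C: "f 0 \<in> C" "finite C" "card C \<le> m - 1" "\<And>u. u \<in> C \<Longrightarrow> nbh G u \<subseteq> C"
    using small[of "f 0"] by blast
  have step: "f j \<in> C" if "f i \<in> C" "i < m" "j < m" "{i, j} \<in> edges T" for i j
    using C(4)[OF that(1)] f(3)[of i j] that V by auto
  have near: "f i \<in> C" if "1 \<le> i" "i \<le> m - 3" for i
    using nb(1) C(4)[OF C(1)] that by (meson atLeastAtMost_iff image_subset_iff subsetD)
  have "f (m - 2) \<in> C \<and> f (m - 1) \<in> C"
  proof -
    consider "{m - 3, m - 2} \<in> edges T" "{m - 2, m - 1} \<in> edges T"
      | "{m - 4, m - 2} \<in> edges T" "{m - 3, m - 1} \<in> edges T"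
      | "{m - 3, m - 2} \<in> edges T" "{m - 3, m - 1} \<in> edges T"
      using T by (auto simp: T_star_def T_one_def T_two_def)
    moreover have "f (m - 3) \<in> C" "f (m - 4) \<in> C" "m - 4 < m" "m - 3 < m" "m - 2 < m" "m - 1 < m"
      using near m by simp_all
    ultimately show ?thesis
      using step by metis
  qed
  moreover have "i = 0 \<or> (1 \<le> i \<and> i \<le> m - 3) \<or> i = m - 2 \<or> i = m - 1" if "i < m" for i
    using that by linarith
  ultimately have "f ` {0..<m} \<subseteq> C"
    using near C(1) by (metis atLeastLessThan_iff image_subsetI)
  then have "card (f ` {0..<m}) \<le> m - 1"
    using card_mono[OF C(2)] C(3) le_trans by metis
  then show False
    using f(1) V m by (simp add: card_image)
qed

lemma no_copy_if_small_degree: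
  assumes G: "simple_graph G" and n: "7 \<le> n" and T: "T \<in> {T_dprime n, T_tprime n, T_three n}"
    and small: "\<And>v. v \<in> verts G \<Longrightarrow> card (nbh G v) \<le> n - 5"
  shows "\<not> contains_copy G T"
proof
  assume "contains_copy G T"
  then obtain f where f: "inj_on f (verts T)" "f ` verts T \<subseteq> verts G"
    "\<And>i j. i \<in> verts T \<Longrightarrow> j \<in> verts T \<Longrightarrow> {i, j} \<in> edges T \<Longrightarrow> f j \<in> nbh G (f i)"
    by (rule contains_copyE) (rule that)
  have V: "verts T = {0..<n}" and star: "(\<lambda>i. {0, i}) ` {1..n - 4} \<subseteq> edges T"
    using T by (auto simp: T_dprime_def T_tprime_def T_three_def)
  have "n - 4 \<le> card (nbh G (f 0))" "f 0 \<in> verts G"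
    using star_degree[OF G V star _ f(1,3)] f(2) V n by auto
  then show False
    using small[of "f 0"] n by linarith
qed

text \<open>The hypotheses \<open>ex\<close> guarantee that the least number is attained. Were it at
  most \<open>p\<close>, the first \<open>?r\<close> vertices of the witness would refute it: an
  induced subgraph raises no degree, in the graph or in the complement, and keeps \<open>C\<close>
  closed.\<close>

lemma less_ramsey_number:
  fixes Tm Tn :: "nat graph"
  assumes real: "realizable m d p" and p: "p \<le> d + n - 4" and m: "7 \<le> m" and n: "7 \<le> n"
    and Tm: "Tm \<in> {T_star m, T_one m, T_two m}"
    and Tn: "Tn \<in> {T_dprime n, T_tprime n, T_three n}"
    and ex: "N > 0" "\<And>G :: nat graph. simple_graph G \<Longrightarrow> card (verts G) = N \<Longrightarrow>
      contains_copy G Tm \<or> contains_copy (graph_complement G) Tn"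
  shows "p < ramsey_number Tm Tn"
proof (rule ccontr)
  let ?r = "ramsey_number Tm Tn"
  assume "\<not> p < ?r"
  then have rp: "?r \<le> p"
    by simp
  have r: "contains_copy G Tm \<or> contains_copy (graph_complement G) Tn"
    if "simple_graph G" "card (verts G) = ?r" for G :: "nat graph"
    using LeastI[of "\<lambda>N. N > 0 \<and> (\<forall>G :: nat graph. simple_graph G \<and> card (verts G) = N \<longrightarrow>
           contains_copy G Tm \<or> contains_copy (graph_complement G) Tn)" N] ex that
    unfolding ramsey_number_def by blast
  obtain E where E: "\<And>i j. E i j \<Longrightarrow> i < p \<and> j < p \<and> i \<noteq> j \<and> E j i"
    and D: "\<And>i. i < p \<Longrightarrow> admissible m d E i"
    using real unfolding realizable_def by blast
  define G where "G = ({0..<?r}, {{i, j} | i j. i < ?r \<and> j < ?r \<and> E i j})"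
  have G: "simple_graph G" "verts G = {0..<?r}"
    using E by (auto simp: G_def simple_graph_def)
  have nbh: "nbh G i = {j. i < ?r \<and> j < ?r \<and> E i j}" for i
    using E by (auto simp: G_def nbh_def doubleton_eq_iff)
  have finE: "finite {j. E i j}" for i
    by (rule finite_subset[of _ "{..<p}"]) (use E in auto)
  have "\<not> contains_copy G Tm"
  proof (rule no_copy_if_small_components[OF G(1) m Tm])
    fix i assume "i \<in> verts G"
    then have "i < p"
      using G rp by simp
    moreover have "card (nbh G i) \<le> card {j. E i j}"
      by (rule card_mono[OF finE]) (auto simp: nbh)
    moreover have "nbh G u \<subseteq> {j. E u j}" for u
      by (auto simp: nbh)
    ultimately show "card (nbh G i) \<le> m - 4 \<or>
      (\<exists>C. i \<in> C \<and> finite C \<and> card C \<le> m - 1 \<and> (\<forall>u\<in>C. nbh G u \<subseteq> C))"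
      using D[of i] le_trans subset_trans unfolding admissible_def by metis
  qed
  moreover have "\<not> contains_copy (graph_complement G) Tn"
  proof (rule no_copy_if_small_degree[OF simple_graph_complement[OF G(1)] n Tn])
    fix i assume "i \<in> verts (graph_complement G)"
    then have i: "i \<in> verts G"
      by (simp add: graph_complement_def)
    then have ip: "i < p"
      using G rp by simp
    \<comment> \<open>Non-neighbours are counted among all \<open>p\<close> vertices, since the
      lower bound \<open>d\<close> on degrees may be lost in the restriction to \<open>?r\<close>
      vertices.\<close>
    have "card (nbh (graph_complement G) i) \<le> card ({0..<p} - insert i {j. E i j})"
      using i rp by (intro card_mono) (auto simp: nbh_complement nbh G)
    also have "\<dots> = p - Suc (card {j. E i j})"
    proof -
      have "insert i {j. E i j} \<subseteq> {0..<p}" "i \<notin> {j. E i j}"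
        using E ip by auto
      then show ?thesis
        using finE[of i] by (simp add: card_Diff_subset)
    qed
    also have "\<dots> \<le> n - 5"
      using D[OF ip, unfolded admissible_def] p n by linarith
    finally show "card (nbh (graph_complement G) i) \<le> n - 5" .
  qed
  ultimately show False
    using r[OF G(1)] G(2) by auto
qed

section \<open>Embedding the six trees\<close>

lemma T_star_simple: "5 \<le> k \<Longrightarrow> simple_graph (T_star k)"
  by (auto simp: T_star_def simple_graph_def)

lemma T_one_simple: "6 \<le> k \<Longrightarrow> simple_graph (T_one k)"
  by (auto simp: T_one_def simple_graph_def)

lemma T_two_simple: "5 \<le> k \<Longrightarrow> simple_graph (T_two k)"
  by (auto simp: T_two_def simple_graph_def)

lemma T_three_simple: "7 \<le> k \<Longrightarrow> simple_graph (T_three k)"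
  by (auto simp: T_three_def simple_graph_def)

lemma T_dprime_simple: "7 \<le> k \<Longrightarrow> simple_graph (T_dprime k)"
  by (auto simp: T_dprime_def simple_graph_def)

lemma T_tprime_simple: "7 \<le> k \<Longrightarrow> simple_graph (T_tprime k)"
  by (auto simp: T_tprime_def simple_graph_def)

text \<open>The path \<open>x\<close>, \<open>y\<close>, \<open>z\<close> hangs at the centre
  \<open>c\<close>. As \<open>y\<close> and \<open>z\<close> may be neighbours of \<open>c\<close>,
  they are set aside before the neighbours are counted, while \<open>x\<close> is one of the
  \<open>k - 3\<close>. The next five lemmas follow this pattern.\<close>

lemma copy_T_star:
  assumes G: "simple_graph G" and k: "8 \<le> k"
    and adj: "x \<in> nbh G c" "y \<in> nbh G x" "z \<in> nbh G y"
    and ne: "y \<noteq> c" "z \<noteq> c" "z \<noteq> x"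
    and card: "k - 3 \<le> card (nbh G c - {y, z})"
  shows "contains_copy G (T_star k)"
proof -
  have V: "c \<in> verts G" "x \<in> verts G" "y \<in> verts G" "z \<in> verts G" "nbh G c \<subseteq> verts G"
    using adj by (auto dest: nbh_verts[OF G])
  have ne': "x \<noteq> c" "x \<noteq> y" "y \<noteq> z"
    using adj by (auto dest: nbh_verts(3)[OF G])
  have "card (nbh G c - {y, z} - {x}) = card (nbh G c - {y, z}) - 1"
    using adj ne ne' by (subst card_Diff_subset) auto
  then have "k - 4 \<le> card (nbh G c - {y, z} - {x})"
    using card by linarith
  then obtain rs where rs: "distinct rs" "set rs \<subseteq> nbh G c - {y, z} - {x}" "length rs = k - 4"
    by (rule obtain_list_of_length)
  then have k': "k = length rs + 4"
    using k by simp
  have "simple_graph (T_star k)"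
    using k by (simp add: T_star_simple)
  then show ?thesis
    unfolding T_star_def
  proof (rule contains_copy_nth[where c = c and ms = "rs @ [x]" and ys = "[y, z]"])
    show "distinct (c # (rs @ [x]) @ [y, z])"
      using rs ne ne' adj nbh_irrefl[OF G, of c] by auto
    show "1 + length (rs @ [x]) + length [y, z] = k" "length (rs @ [x]) = k - 3"
      using rs(3) k by auto
    show "set (rs @ [x]) \<subseteq> verts G \<inter> nbh G c"
      using rs(2) adj V by auto
    show "c \<in> verts G" "set [y, z] \<subseteq> verts G"
      using V by simp_all
    fix e assume "e \<in> {{k - 3, k - 2}, {k - 2, k - 1}}"
    then show "(!) (c # (rs @ [x]) @ [y, z]) ` e \<in> edges G"
      using adj by (auto simp: k' nth_append nbh_def insert_commute)
  qed
qed

lemma copy_T_one: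
  assumes G: "simple_graph G" and k: "8 \<le> k"
    and adj: "x1 \<in> nbh G c" "x2 \<in> nbh G c" "y1 \<in> nbh G x1" "y2 \<in> nbh G x2"
    and ne: "x1 \<noteq> x2" "y1 \<noteq> y2" "y1 \<noteq> c" "y2 \<noteq> c" "y1 \<noteq> x2" "y2 \<noteq> x1"
    and card: "k - 3 \<le> card (nbh G c - {y1, y2})"
  shows "contains_copy G (T_one k)"
proof -
  have V: "c \<in> verts G" "x1 \<in> verts G" "x2 \<in> verts G" "y1 \<in> verts G" "y2 \<in> verts G" "nbh G c \<subseteq> verts G"
    using adj by (auto dest: nbh_verts[OF G])
  have ne': "x1 \<noteq> c" "x2 \<noteq> c" "x1 \<noteq> y1" "x2 \<noteq> y2"
    using adj by (auto dest: nbh_verts(3)[OF G])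
  have "card (nbh G c - {y1, y2} - {x1, x2}) = card (nbh G c - {y1, y2}) - 2"
    using adj ne ne' by (subst card_Diff_subset) auto
  then have "k - 5 \<le> card (nbh G c - {y1, y2} - {x1, x2})"
    using card by linarith
  then obtain rs where rs: "distinct rs" "set rs \<subseteq> nbh G c - {y1, y2} - {x1, x2}" "length rs = k - 5"
    by (rule obtain_list_of_length)
  then have k': "k = length rs + 5"
    using k by simp
  have "simple_graph (T_one k)"
    using k by (simp add: T_one_simple)
  then show ?thesis
    unfolding T_one_def
  proof (rule contains_copy_nth[where c = c and ms = "rs @ [x1, x2]" and ys = "[y1, y2]"])
    show "distinct (c # (rs @ [x1, x2]) @ [y1, y2])"
      using rs ne ne' adj nbh_irrefl[OF G, of c] by auto
    show "1 + length (rs @ [x1, x2]) + length [y1, y2] = k" "length (rs @ [x1, x2]) = k - 3"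
      using rs(3) k by auto
    show "set (rs @ [x1, x2]) \<subseteq> verts G \<inter> nbh G c"
      using rs(2) adj V by auto
    show "c \<in> verts G" "set [y1, y2] \<subseteq> verts G"
      using V by simp_all
    fix e assume "e \<in> {{k - 4, k - 2}, {k - 3, k - 1}}"
    then show "(!) (c # (rs @ [x1, x2]) @ [y1, y2]) ` e \<in> edges G"
      using adj by (auto simp: k' nth_append nbh_def insert_commute)
  qed
qed

lemma copy_T_two:
  assumes G: "simple_graph G" and k: "8 \<le> k"
    and adj: "x \<in> nbh G c" "y1 \<in> nbh G x" "y2 \<in> nbh G x"
    and ne: "y1 \<noteq> y2" "y1 \<noteq> c" "y2 \<noteq> c"
    and card: "k - 3 \<le> card (nbh G c - {y1, y2})"
  shows "contains_copy G (T_two k)"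
proof -
  have V: "c \<in> verts G" "x \<in> verts G" "y1 \<in> verts G" "y2 \<in> verts G" "nbh G c \<subseteq> verts G"
    using adj by (auto dest: nbh_verts[OF G])
  have ne': "x \<noteq> c" "x \<noteq> y1" "x \<noteq> y2"
    using adj by (auto dest: nbh_verts(3)[OF G])
  have "card (nbh G c - {y1, y2} - {x}) = card (nbh G c - {y1, y2}) - 1"
    using adj ne ne' by (subst card_Diff_subset) auto
  then have "k - 4 \<le> card (nbh G c - {y1, y2} - {x})"
    using card by linarith
  then obtain rs where rs: "distinct rs" "set rs \<subseteq> nbh G c - {y1, y2} - {x}" "length rs = k - 4"
    by (rule obtain_list_of_length)
  then have k': "k = length rs + 4"
    using k by simp
  have "simple_graph (T_two k)"
    using k by (simp add: T_two_simple)
  then show ?thesis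
    unfolding T_two_def
  proof (rule contains_copy_nth[where c = c and ms = "rs @ [x]" and ys = "[y1, y2]"])
    show "distinct (c # (rs @ [x]) @ [y1, y2])"
      using rs ne ne' adj nbh_irrefl[OF G, of c] by auto
    show "1 + length (rs @ [x]) + length [y1, y2] = k" "length (rs @ [x]) = k - 3"
      using rs(3) k by auto
    show "set (rs @ [x]) \<subseteq> verts G \<inter> nbh G c"
      using rs(2) adj V by auto
    show "c \<in> verts G" "set [y1, y2] \<subseteq> verts G"
      using V by simp_all
    fix e assume "e \<in> {{k - 3, k - 2}, {k - 3, k - 1}}"
    then show "(!) (c # (rs @ [x]) @ [y1, y2]) ` e \<in> edges G"
      using adj by (auto simp: k' nth_append nbh_def insert_commute)
  qed
qed

lemma copy_T_three:
  assumes G: "simple_graph G" and k: "8 \<le> k"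
    and adj: "x \<in> nbh G c" "y1 \<in> nbh G x" "y2 \<in> nbh G x" "y3 \<in> nbh G x"
    and ne: "y1 \<noteq> y2" "y1 \<noteq> y3" "y2 \<noteq> y3" "y1 \<noteq> c" "y2 \<noteq> c" "y3 \<noteq> c"
    and card: "k - 4 \<le> card (nbh G c - {y1, y2, y3})"
  shows "contains_copy G (T_three k)"
proof -
  have V: "c \<in> verts G" "x \<in> verts G" "y1 \<in> verts G" "y2 \<in> verts G" "y3 \<in> verts G" "nbh G c \<subseteq> verts G"
    using adj by (auto dest: nbh_verts[OF G])
  have ne': "x \<noteq> c" "x \<noteq> y1" "x \<noteq> y2" "x \<noteq> y3"
    using adj by (auto dest: nbh_verts(3)[OF G])
  have "card (nbh G c - {y1, y2, y3} - {x}) = card (nbh G c - {y1, y2, y3}) - 1"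
    using adj ne ne' by (subst card_Diff_subset) auto
  then have "k - 5 \<le> card (nbh G c - {y1, y2, y3} - {x})"
    using card by linarith
  then obtain rs where rs: "distinct rs" "set rs \<subseteq> nbh G c - {y1, y2, y3} - {x}" "length rs = k - 5"
    by (rule obtain_list_of_length)
  then have k': "k = length rs + 5"
    using k by simp
  have "simple_graph (T_three k)"
    using k by (simp add: T_three_simple)
  then show ?thesis
    unfolding T_three_def
  proof (rule contains_copy_nth[where c = c and ms = "rs @ [x]" and ys = "[y1, y2, y3]"])
    show "distinct (c # (rs @ [x]) @ [y1, y2, y3])"
      using rs ne ne' adj nbh_irrefl[OF G, of c] by auto
    show "1 + length (rs @ [x]) + length [y1, y2, y3] = k" "length (rs @ [x]) = k - 4"
      using rs(3) k by auto
    show "set (rs @ [x]) \<subseteq> verts G \<inter> nbh G c"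
      using rs(2) adj V by auto
    show "c \<in> verts G" "set [y1, y2, y3] \<subseteq> verts G"
      using V by simp_all
    fix e assume "e \<in> {{k - 4, k - 3}, {k - 4, k - 2}, {k - 4, k - 1}}"
    then show "(!) (c # (rs @ [x]) @ [y1, y2, y3]) ` e \<in> edges G"
      using adj by (auto simp: k' nth_append nbh_def insert_commute)
  qed
qed

lemma copy_T_dprime:
  assumes G: "simple_graph G" and k: "8 \<le> k"
    and adj: "x1 \<in> nbh G c" "x2 \<in> nbh G c" "y1 \<in> nbh G x1" "y2 \<in> nbh G x1" "y3 \<in> nbh G x2"
    and ne: "x1 \<noteq> x2" "y1 \<noteq> y2" "y1 \<noteq> y3" "y2 \<noteq> y3" "y1 \<noteq> c" "y2 \<noteq> c" "y3 \<noteq> c" "y1 \<noteq> x2" "y2 \<noteq> x2" "y3 \<noteq> x1"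
    and card: "k - 4 \<le> card (nbh G c - {y1, y2, y3})"
  shows "contains_copy G (T_dprime k)"
proof -
  have V: "c \<in> verts G" "x1 \<in> verts G" "x2 \<in> verts G" "y1 \<in> verts G" "y2 \<in> verts G" "y3 \<in> verts G" "nbh G c \<subseteq> verts G"
    using adj by (auto dest: nbh_verts[OF G])
  have ne': "x1 \<noteq> c" "x2 \<noteq> c" "x1 \<noteq> y1" "x1 \<noteq> y2" "x2 \<noteq> y3"
    using adj by (auto dest: nbh_verts(3)[OF G])
  have "card (nbh G c - {y1, y2, y3} - {x1, x2}) = card (nbh G c - {y1, y2, y3}) - 2"
    using adj ne ne' by (subst card_Diff_subset) auto
  then have "k - 6 \<le> card (nbh G c - {y1, y2, y3} - {x1, x2})"
    using card by linarith
  then obtain rs where rs: "distinct rs" "set rs \<subseteq> nbh G c - {y1, y2, y3} - {x1, x2}" "length rs = k - 6"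
    by (rule obtain_list_of_length)
  then have k': "k = length rs + 6"
    using k by simp
  have "simple_graph (T_dprime k)"
    using k by (simp add: T_dprime_simple)
  then show ?thesis
    unfolding T_dprime_def
  \<comment> \<open>The extra edges start from the indices 1 and 2, so \<open>x1\<close> and
    \<open>x2\<close> come first in the list.\<close>
  proof (rule contains_copy_nth[where c = c and ms = "[x1, x2] @ rs" and ys = "[y1, y2, y3]"])
    show "distinct (c # ([x1, x2] @ rs) @ [y1, y2, y3])"
      using rs ne ne' adj nbh_irrefl[OF G, of c] by auto
    show "1 + length ([x1, x2] @ rs) + length [y1, y2, y3] = k" "length ([x1, x2] @ rs) = k - 4"
      using rs(3) k by auto
    show "set ([x1, x2] @ rs) \<subseteq> verts G \<inter> nbh G c"
      using rs(2) adj V by auto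
    show "c \<in> verts G" "set [y1, y2, y3] \<subseteq> verts G"
      using V by simp_all
    fix e assume "e \<in> {{1, k - 3}, {1, k - 2}, {2, k - 1}}"
    then show "(!) (c # ([x1, x2] @ rs) @ [y1, y2, y3]) ` e \<in> edges G"
      using adj by (auto simp: k' nth_append nbh_def insert_commute)
  qed
qed

lemma copy_T_tprime:
  assumes G: "simple_graph G" and k: "8 \<le> k"
    and adj: "x1 \<in> nbh G c" "x2 \<in> nbh G c" "x3 \<in> nbh G c" "y1 \<in> nbh G x1" "y2 \<in> nbh G x2" "y3 \<in> nbh G x3"
    and ne: "x1 \<noteq> x2" "x1 \<noteq> x3" "x2 \<noteq> x3" "y1 \<noteq> y2" "y1 \<noteq> y3" "y2 \<noteq> y3" "y1 \<noteq> c" "y2 \<noteq> c" "y3 \<noteq> c" "y1 \<noteq> x2" "y1 \<noteq> x3" "y2 \<noteq> x1" "y2 \<noteq> x3" "y3 \<noteq> x1" "y3 \<noteq> x2"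
    and card: "k - 4 \<le> card (nbh G c - {y1, y2, y3})"
  shows "contains_copy G (T_tprime k)"
proof -
  have V: "c \<in> verts G" "x1 \<in> verts G" "x2 \<in> verts G" "x3 \<in> verts G" "y1 \<in> verts G" "y2 \<in> verts G" "y3 \<in> verts G" "nbh G c \<subseteq> verts G"
    using adj by (auto dest: nbh_verts[OF G])
  have ne': "x1 \<noteq> c" "x2 \<noteq> c" "x3 \<noteq> c" "x1 \<noteq> y1" "x2 \<noteq> y2" "x3 \<noteq> y3"
    using adj by (auto dest: nbh_verts(3)[OF G])
  have "card (nbh G c - {y1, y2, y3} - {x1, x2, x3}) = card (nbh G c - {y1, y2, y3}) - 3"
    using adj ne ne' by (subst card_Diff_subset) auto
  then have "k - 7 \<le> card (nbh G c - {y1, y2, y3} - {x1, x2, x3})"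
    using card by linarith
  then obtain rs where rs: "distinct rs" "set rs \<subseteq> nbh G c - {y1, y2, y3} - {x1, x2, x3}" "length rs = k - 7"
    by (rule obtain_list_of_length)
  then have k': "k = length rs + 7"
    using k by simp
  have "simple_graph (T_tprime k)"
    using k by (simp add: T_tprime_simple)
  then show ?thesis
    unfolding T_tprime_def
  proof (rule contains_copy_nth[where c = c and ms = "[x1, x2, x3] @ rs" and ys = "[y1, y2, y3]"])
    show "distinct (c # ([x1, x2, x3] @ rs) @ [y1, y2, y3])"
      using rs ne ne' adj nbh_irrefl[OF G, of c] by auto
    show "1 + length ([x1, x2, x3] @ rs) + length [y1, y2, y3] = k" "length ([x1, x2, x3] @ rs) = k - 4"
      using rs(3) k by auto
    show "set ([x1, x2, x3] @ rs) \<subseteq> verts G \<inter> nbh G c"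
      using rs(2) adj V by auto
    show "c \<in> verts G" "set [y1, y2, y3] \<subseteq> verts G"
      using V by simp_all
    fix e assume "e \<in> {{1, k - 3}, {2, k - 2}, {3, k - 1}}"
    then show "(!) (c # ([x1, x2, x3] @ rs) @ [y1, y2, y3]) ` e \<in> edges G"
      using adj by (auto simp: k' nth_append nbh_def insert_commute)
  qed
qed

section \<open>Forcing the smaller tree\<close>

lemma ex_in_Diff:
  assumes "finite F" "card F < card S"
  shows "\<exists>x\<in>S. x \<notin> F"
  using assms by (meson card_mono not_less subsetI)

lemma card_Diff_ge:
  assumes "finite F" "k + card F \<le> card S"
  shows "k \<le> card (S - F)"
  using diff_card_le_card_Diff[OF assms(1), of S] assms(2) by linarith

lemma card_doubleton_le: "card {a, b} \<le> 2" and card_triple_le: "card {a, b, c} \<le> 3"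
  by (auto simp: card_insert_if)

text \<open>By \<open>ext\<close> there is a path \<open>v\<close>, \<open>x\<close>,
  \<open>w\<close> such that \<open>v\<close> keeps \<open>m - 2\<close> neighbours besides
  \<open>w\<close>. With \<open>w\<close> outside the star, the second such vertex may cost one more
  neighbour of \<open>v\<close>; it is found greedily, as degrees of at least 7 exceed the at most
  three vertices to avoid.\<close>

lemma copies_if_min_degree:
  assumes G: "simple_graph G" and m: "9 \<le> m" and v: "v \<in> W"
    and deg: "\<And>w. w \<in> W \<Longrightarrow> m - 2 \<le> card (nbh G w \<inter> W)"
    and ext: "m - 1 \<le> card (nbh G v \<inter> W)
      \<or> (\<exists>x\<in>nbh G v \<inter> W. \<exists>w\<in>W. w \<noteq> v \<and> w \<notin> nbh G v \<and> w \<in> nbh G x)"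
  shows "\<forall>T\<in>{T_star m, T_one m, T_two m}. contains_copy G T"
proof -
  note fin = finite_nbh[OF G]
  have ext_nb: "\<exists>u\<in>nbh G w \<inter> W. u \<notin> F" if "w \<in> W" "finite F" "card F \<le> 3" for w F
    using ex_in_Diff[of F "nbh G w \<inter> W"] deg[OF that(1)] that m by linarith
  have le: "k \<le> card (nbh G v - F)" if "k \<le> card (nbh G v \<inter> W - F)" for k F
    using that fin by (meson Diff_mono Int_lower1 card_mono finite_Diff le_trans subset_refl)
  obtain x w where xw: "x \<in> nbh G v \<inter> W" "w \<in> nbh G x \<inter> W" "w \<noteq> v" "m - 2 \<le> card (nbh G v - {w})"
  proof (cases "m - 1 \<le> card (nbh G v \<inter> W)")
    case True
    obtain x where x: "x \<in> nbh G v \<inter> W"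
      using ext_nb[OF v, of "{}"] by auto
    then obtain w where w: "w \<in> nbh G x \<inter> W" "w \<noteq> v"
      using ext_nb[of x "{v}"] by auto
    have "m - 2 \<le> card (nbh G v - {w})"
      using True m by (intro le card_Diff_ge) auto
    then show thesis
      using that x w by blast
  next
    case False
    then obtain x w where xw: "x \<in> nbh G v \<inter> W" "w \<in> W" "w \<noteq> v" "w \<notin> nbh G v" "w \<in> nbh G x"
      using ext by blast
    moreover have "m - 2 \<le> card (nbh G v - {w})"
      using deg[OF v] xw(4) by (intro le) auto
    ultimately show thesis
      using that by blast
  qed
  have leaves: "m - 3 \<le> card (nbh G v - {w, u})" for u
  proof -
    have "m - 3 \<le> card (nbh G v - {w} - {u})"
      by (rule card_Diff_ge) (use xw(4) m in auto)
    moreover have "nbh G v - {w} - {u} = nbh G v - {w, u}"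
      by auto
    ultimately show ?thesis
      by simp
  qed
  have ne: "x \<noteq> v" "w \<noteq> x"
    using xw nbh_verts(3)[OF G] by (auto simp: nbh_irrefl[OF G])
  have "contains_copy G (T_star m)"
  proof -
    obtain z where "z \<in> nbh G w \<inter> W" "z \<notin> {v, x}"
      using ext_nb[of w "{v, x}"] xw by (auto simp: card_triple_le card_doubleton_le[THEN order_trans])
    then show ?thesis
      using copy_T_star[OF G, of m x v w z] xw m leaves by auto
  qed
  moreover have "contains_copy G (T_one m)"
  proof -
    obtain x2 where x2: "x2 \<in> nbh G v \<inter> W" "x2 \<notin> {x, w}"
      using ext_nb[OF v, of "{x, w}"] by (auto simp: card_triple_le card_doubleton_le[THEN order_trans])
    then obtain y2 where "y2 \<in> nbh G x2 \<inter> W" "y2 \<notin> {v, x, w}"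
      using ext_nb[of x2 "{v, x, w}"] by (auto simp: card_triple_le card_doubleton_le[THEN order_trans])
    then show ?thesis
      using copy_T_one[OF G, of m x v x2 w y2] xw m leaves x2 by auto
  qed
  moreover have "contains_copy G (T_two m)"
  proof -
    obtain y2 where "y2 \<in> nbh G x \<inter> W" "y2 \<notin> {v, w}"
      using ext_nb[of x "{v, w}"] xw by (auto simp: card_triple_le card_doubleton_le[THEN order_trans])
    then show ?thesis
      using copy_T_two[OF G, of m x v w y2] xw m leaves by auto
  qed
  ultimately show ?thesis
    by blast
qed

text \<open>As \<open>copies_if_min_degree\<close> cannot apply at any vertex, all degrees equal
  \<open>m - 2\<close> and no two vertices are at distance two. So closed neighbourhoods of adjacent
  vertices coincide and partition the graph into blocks of size \<open>m - 1\<close>.\<close>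

lemma dvd_card_verts_if_min_degree:
  assumes G: "simple_graph G" and m: "9 \<le> m"
    and deg: "\<And>v. v \<in> verts G \<Longrightarrow> m - 2 \<le> card (nbh G v)"
    and noG: "\<not> (\<forall>T\<in>{T_star m, T_one m, T_two m}. contains_copy G T)"
  shows "(m - 1) dvd card (verts G)"
proof -
  have fin: "finite (verts G)"
    using G by (simp add: simple_graph_def)
  have inV: "nbh G v \<inter> verts G = nbh G v" for v
    using nbh_verts(1)[OF G] by auto
  have no_ext: "\<not> (m - 1 \<le> card (nbh G v)
      \<or> (\<exists>x\<in>nbh G v. \<exists>w\<in>verts G. w \<noteq> v \<and> w \<notin> nbh G v \<and> w \<in> nbh G x))"
    if "v \<in> verts G" for v
    using copies_if_min_degree[OF G m that] deg noG unfolding inV by blast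
  let ?N = "\<lambda>v. insert v (nbh G v)"
  have closed: "?N w = ?N v" if v: "v \<in> verts G" and w: "w \<in> nbh G v" for v w
  proof -
    have "?N y \<subseteq> ?N x" if "x \<in> verts G" "y \<in> nbh G x" for x y
      using no_ext[OF that(1)] that(2) nbh_verts(1)[OF G] by blast
    then show ?thesis
      using v w nbh_verts(1)[OF G w] nbh_sym[of v G w] by blast
  qed
  have "(m - 1) * card (?N ` verts G) = card (\<Union> (?N ` verts G))"
  proof (rule card_partition)
    show "finite (?N ` verts G)" "finite (\<Union> (?N ` verts G))"
      using fin finite_nbh[OF G] by auto
    show "card c = m - 1" if c: "c \<in> ?N ` verts G" for c
    proof -
      obtain v where v: "v \<in> verts G" "c = ?N v"
        using c by blast
      have "card (nbh G v) = m - 2"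
        using no_ext[OF v(1)] deg[OF v(1)] by linarith
      then show ?thesis
        using v nbh_irrefl[OF G, of v] finite_nbh[OF G, of v] m by simp
    qed
    show "c1 \<inter> c2 = {}" if "c1 \<in> ?N ` verts G" "c2 \<in> ?N ` verts G" "c1 \<noteq> c2" for c1 c2
      using that closed by blast
  qed
  moreover have "\<Union> (?N ` verts G) = verts G"
    using nbh_verts(1)[OF G] by blast
  ultimately show ?thesis
    by (metis dvd_triv_left)
qed

text \<open>Degrees inside \<open>A\<close> are at least \<open>card A - 3\<close>. A vertex of
  \<open>A\<close> not adjacent to \<open>a\<close> misses too few vertices to avoid all neighbours
  of \<open>a\<close>; if there is none, \<open>a\<close> is adjacent to the rest of
  \<open>A\<close>. Either way \<open>copies_if_min_degree\<close> applies.\<close>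

lemma copies_if_almost_complete:
  assumes G: "simple_graph G" and m: "9 \<le> m" and A: "finite A" "m + 1 \<le> card A"
    and miss: "\<And>a. a \<in> A \<Longrightarrow> card (A - {a} - nbh G a) \<le> 2"
  shows "\<forall>T\<in>{T_star m, T_one m, T_two m}. contains_copy G T"
proof -
  have deg: "card A \<le> card (nbh G a \<inter> A) + 3" if "a \<in> A" for a
  proof -
    have "A = nbh G a \<inter> A \<union> (insert a (A - {a} - nbh G a))"
      using that by auto
    then have "card A \<le> card (nbh G a \<inter> A) + card (insert a (A - {a} - nbh G a))"
      by (metis card_Un_le)
    also have "card (insert a (A - {a} - nbh G a)) \<le> Suc (card (A - {a} - nbh G a))"
      by (rule card_insert_le_m1) auto
    finally show ?thesis
      using miss[OF that] by linarith
  qed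
  obtain a where a: "a \<in> A"
    using A m by (metis card.empty equals0I not_less_eq_eq le0 add.commute plus_1_eq_Suc)
  show ?thesis
  proof (rule copies_if_min_degree[OF G m a])
    show "m - 2 \<le> card (nbh G w \<inter> A)" if "w \<in> A" for w
      using deg[OF that] A by linarith
    show "m - 1 \<le> card (nbh G a \<inter> A)
      \<or> (\<exists>x\<in>nbh G a \<inter> A. \<exists>w\<in>A. w \<noteq> a \<and> w \<notin> nbh G a \<and> w \<in> nbh G x)"
    proof (rule disjCI)
      assume "\<not> (\<exists>x\<in>nbh G a \<inter> A. \<exists>w\<in>A. w \<noteq> a \<and> w \<notin> nbh G a \<and> w \<in> nbh G x)"
      then have *: "nbh G a \<inter> A \<subseteq> A - {w} - nbh G w" if "w \<in> A" "w \<noteq> a" "w \<notin> nbh G a" for w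
        using that nbh_sym[of w G] by blast
      have "A \<subseteq> insert a (nbh G a)"
      proof (rule ccontr)
        assume "\<not> A \<subseteq> insert a (nbh G a)"
        then obtain w where w: "w \<in> A" "w \<noteq> a" "w \<notin> nbh G a"
          by blast
        have "card (nbh G a \<inter> A) \<le> 2"
          using card_mono[OF _ *[OF w]] miss[OF w(1)] A(1) by fastforce
        then show False
          using deg[OF a] A m by linarith
      qed
      then have "A - {a} \<subseteq> nbh G a \<inter> A"
        by blast
      then have "card (A - {a}) \<le> card (nbh G a \<inter> A)"
        using A by (intro card_mono) auto
      then show "m - 1 \<le> card (nbh G a \<inter> A)"
        using a A by (simp add: card_Diff_singleton)
    qed
  qed
qed

text \<open>Five vertices of \<open>K\<close> suffice for the centre and all ends of extra edges;
  the remaining leaves may come from \<open>L\<close>, inside which no edges are assumed.\<close>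

lemma copies_if_clique:
  assumes G: "simple_graph G" and m: "9 \<le> m" and fin: "finite K" "finite L" "K \<inter> L = {}"
    and card: "5 \<le> card K" "m \<le> card K + card L"
    and adj: "\<And>a b. a \<in> K \<Longrightarrow> b \<in> K \<union> L \<Longrightarrow> a \<noteq> b \<Longrightarrow> b \<in> nbh G a"
  shows "\<forall>T\<in>{T_star m, T_one m, T_two m}. contains_copy G T"
proof -
  obtain xs where xs: "distinct xs" "set xs \<subseteq> K" "length xs = 5"
    by (rule obtain_list_of_length[OF card(1)])
  then obtain c x1 x2 y1 y2 where "xs = [c, x1, x2, y1, y2]"
    by (auto simp: numeral_eq_Suc length_Suc_conv)
  then have K: "{c, x1, x2, y1, y2} \<subseteq> K" and d: "distinct [c, x1, x2, y1, y2]"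
    using xs by auto
  have "m - 3 \<le> card (K \<union> L - {c, y1, y2})"
    using d card fin m by (intro card_Diff_ge) (auto simp: card_Un_disjoint card_insert_if)
  moreover have "K \<union> L - {c, y1, y2} \<subseteq> nbh G c - {y1, y2}"
    using K adj by auto
  ultimately have leaves: "m - 3 \<le> card (nbh G c - {y1, y2})"
    by (meson G card_mono finite_Diff finite_nbh le_trans)
  have "contains_copy G (T_star m)"
    using copy_T_star[OF G, of m x1 c y1 y2] K d adj leaves m by auto
  moreover have "contains_copy G (T_one m)"
    using copy_T_one[OF G, of m x1 c x2 y1 y2] K d adj leaves m by auto
  moreover have "contains_copy G (T_two m)"
    using copy_T_two[OF G, of m x1 c y1 y2] K d adj leaves m by auto
  ultimately show ?thesis
    by blast
qed

text \<open>The vertices of a maximal matching form a vertex cover.\<close>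

lemma no_three_disjoint_pairs:
  assumes no: "\<And>a1 c1 a2 c2 a3 c3. (a1, c1) \<in> R \<Longrightarrow> (a2, c2) \<in> R \<Longrightarrow> (a3, c3) \<in> R
    \<Longrightarrow> {a2, c2} \<inter> {a1, c1} = {} \<Longrightarrow> {a3, c3} \<inter> {a1, c1, a2, c2} = {} \<Longrightarrow> False"
  obtains P Q where "P \<subseteq> Domain R" "Q \<subseteq> Range R" "finite P" "finite Q" "card P \<le> 2" "card Q \<le> 2"
    "\<And>a c. (a, c) \<in> R \<Longrightarrow> a \<in> P \<union> Q \<or> c \<in> P \<union> Q"
proof (cases "R = {}")
  case True
  show thesis
    by (rule that[of "{}" "{}"]) (use True in auto)
next
  case False
  then obtain a1 c1 where R1: "(a1, c1) \<in> R"
    by auto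
  show thesis
  proof (cases "\<exists>a2 c2. (a2, c2) \<in> R \<and> {a2, c2} \<inter> {a1, c1} = {}")
    case False
    show thesis
      by (rule that[of "{a1}" "{c1}"]) (use False R1 in auto)
  next
    case True
    then obtain a2 c2 where R2: "(a2, c2) \<in> R" "{a2, c2} \<inter> {a1, c1} = {}"
      by blast
    show thesis
    proof (rule that[of "{a1, a2}" "{c1, c2}"])
      fix a c assume "(a, c) \<in> R"
      then show "a \<in> {a1, a2} \<union> {c1, c2} \<or> c \<in> {a1, a2} \<union> {c1, c2}"
        using no[OF R1 R2(1) _ R2(2), of a c] by auto
    qed (use R1 R2 in \<open>auto simp: card_doubleton_le\<close>)
  qed
qed

text \<open>The locale is used with \<^term>\<open>v\<close> of large degree in the complement. Then \<^term>\<open>A\<close> and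
  \<^term>\<open>B\<close> are almost completely joined in \<^term>\<open>G\<close>, and every vertex of \<^term>\<open>B\<close>
  is joined to \<^term>\<open>v\<close>, which serves as the inner vertex of the tree.\<close>

locale split_at_vertex =
  fixes G :: "'a graph" and v :: 'a and m n :: nat and A B :: "'a set"
  assumes G: "simple_graph G" and v: "v \<in> verts G" and card_verts: "card (verts G) = m + n - 6"
    and m: "9 \<le> m" and mn: "m + 2 \<le> n"
    and A_def: "A = nbh (graph_complement G) v" and B_def: "B = nbh G v"
    and card_A: "n - 4 \<le> card A"
begin

lemma fin: "finite A" "finite B"
  unfolding A_def B_def using G by (auto intro: finite_nbh simple_graph_complement)

lemma split: "v \<notin> A" "v \<notin> B" "A \<inter> B = {}" "insert v (A \<union> B) = verts G"
  using G v by (auto simp: A_def B_def nbh_complement nbh_irrefl dest: nbh_verts[OF G])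

lemma card_split: "card A + card B = m + n - 7"
  using card_nbh_complement[OF G v] card_verts m mn by (simp add: A_def B_def)

lemma hub: "b \<in> B \<Longrightarrow> v \<in> nbh G b" "b \<in> B \<Longrightarrow> b \<in> nbh G v"
  using nbh_sym[of v G b] by (auto simp: B_def)

text \<open>The vertex \<open>v\<close> is a neighbour of \<open>b\<close> outside \<open>A\<close>,
  so \<open>m - 4\<close> neighbours in \<open>A\<close> suffice.\<close>

lemma hub_leaves:
  assumes "b \<in> B" "S \<subseteq> nbh G b \<inter> A - F" "m - 4 \<le> card S" "v \<notin> F"
  shows "m - 3 \<le> card (nbh G b - F)"
proof -
  have "finite S" "v \<notin> S"
    using assms(2) fin(1) split(1) finite_subset[of S A] by auto
  then have "m - 3 \<le> card (insert v S)"
    using assms(3) m by simp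
  also have "\<dots> \<le> card (nbh G b - F)"
    using assms hub(1)[OF assms(1)] by (intro card_mono) (auto simp: finite_nbh[OF G])
  finally show ?thesis .
qed

text \<open>With centre \<open>b\<close>, at least one of the two vertices outside the star hangs
  from \<open>v\<close>. Both lie in \<open>B\<close> and take no leaf from
  \<open>A\<close>.\<close>

lemma T_one_T_two_at_hub:
  assumes b: "b \<in> B" "m - 4 \<le> card (nbh G b \<inter> A)" and B: "3 \<le> card B"
    and a: "a \<in> nbh G b \<inter> A" "b2 \<in> nbh G a \<inter> B" "b2 \<noteq> b"
  shows "contains_copy G (T_one m)" "contains_copy G (T_two m)"
proof -
  obtain b1 where b1: "b1 \<in> B" "b1 \<notin> {b, b2}"
    using ex_in_Diff[of "{b, b2}" B] B card_doubleton_le[of b b2] by auto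
  have ne: "b \<noteq> v" "b1 \<noteq> v" "b2 \<noteq> v" "a \<noteq> v" "a \<noteq> b1" "a \<noteq> b2" "a \<noteq> b"
    using b b1 a split(1-3) by auto
  have leaves: "m - 3 \<le> card (nbh G b - {b1, b2})"
    by (rule hub_leaves[OF b(1) _ b(2)]) (use ne b1 a split in auto)
  show "contains_copy G (T_one m)"
    using copy_T_one[OF G, of m v b a b1 b2] m b a b1 ne hub leaves by auto
  show "contains_copy G (T_two m)"
    using copy_T_two[OF G, of m v b b1 b2] m b a b1 ne hub leaves by auto
qed

text \<open>The path is \<open>b\<close>, \<open>v\<close>, \<open>y\<close>, \<open>z\<close>; only
  \<open>z\<close> may cost a leaf in \<open>A\<close>.\<close>

lemma T_star_at_hub:
  assumes b: "b \<in> B" "y \<in> B" "y \<noteq> b" "z \<in> A" "z \<in> nbh G y"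
    and card: "m - 4 \<le> card (nbh G b \<inter> A - {z})"
  shows "contains_copy G (T_star m)"
proof -
  have ne: "b \<noteq> v" "y \<noteq> v" "z \<noteq> v" "z \<noteq> b" "z \<noteq> y"
    using b split(1-3) by auto
  have "m - 3 \<le> card (nbh G b - {y, z})"
    by (rule hub_leaves[OF b(1) _ card]) (use ne b split in auto)
  then show ?thesis
    using copy_T_star[OF G, of m v b y z] m b ne hub by auto
qed

lemma copies_if_complete_bipartite:
  assumes sub: "A' \<subseteq> A" "B' \<subseteq> B" and adj: "\<And>a b. a \<in> A' \<Longrightarrow> b \<in> B' \<Longrightarrow> a \<in> nbh G b"
    and card: "m - 3 \<le> card A'" "2 \<le> card B'" "3 \<le> card B"
  shows "\<forall>T\<in>{T_star m, T_one m, T_two m}. contains_copy G T"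
proof -
  obtain b where b: "b \<in> B'"
    using ex_in_Diff[of "{}" B'] card by auto
  obtain b2 where b2: "b2 \<in> B'" "b2 \<noteq> b"
    using ex_in_Diff[of "{b}" B'] card by auto
  have "A' \<noteq> {}"
    using card m by auto
  then obtain a where a: "a \<in> A'"
    by blast
  have sub_nbh: "A' \<subseteq> nbh G b \<inter> A"
    using adj b sub by auto
  have "m - 4 \<le> card (A' - {a})"
    by (rule card_Diff_ge) (use card m in auto)
  moreover have "card (A' - {a}) \<le> card (nbh G b \<inter> A - {a})"
    by (rule card_mono) (use sub_nbh fin in auto)
  ultimately have star: "m - 4 \<le> card (nbh G b \<inter> A - {a})"
    by simp
  moreover have "\<dots> \<le> card (nbh G b \<inter> A)"
    by (rule card_mono) (use fin in auto)
  ultimately have hub: "m - 4 \<le> card (nbh G b \<inter> A)"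
    by simp
  have "a \<in> nbh G b2" "a \<in> nbh G b" "b2 \<in> nbh G a"
    using adj a b b2 nbh_sym[of a G b2] by auto
  then show ?thesis
    using T_one_T_two_at_hub[OF _ hub card(3), of a b2] T_star_at_hub[OF _ _ _ _ _ star, of b2]
      a b b2 sub by auto
qed

text \<open>Every vertex of \<open>A\<close> keeps at least two neighbours in \<open>B\<close>,
  hence one besides the centre \<open>b\<close>; what remains is to find \<open>b\<close> with
  enough neighbours in \<open>A\<close>.\<close>

lemma copies_if_few_missing:
  assumes few: "\<And>a. a \<in> A \<Longrightarrow> card (B - nbh G a) \<le> 2" and A: "card A \<le> n - 2"
  shows "\<forall>T\<in>{T_star m, T_one m, T_two m}. contains_copy G T"
proof -
  have B: "4 \<le> card B"
    using A card_split m mn by linarith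
  have A': "m - 2 \<le> card A"
    using card_A mn by linarith
  have nb: "card B - 2 \<le> card (B \<inter> nbh G a)" if "a \<in> A" for a
  proof -
    have "card (B - nbh G a) = card B - card (B \<inter> nbh G a)"
      using fin by (simp add: card_Diff_subset_Int)
    then show ?thesis
      using few[OF that] by linarith
  qed
  \<comment> \<open>Double counting: some vertex of \<open>B\<close> has at least the average number of neighbours in \<open>A\<close>.\<close>
  have "\<exists>b\<in>B. m - 4 \<le> card (nbh G b \<inter> A)"
  proof (rule ccontr)
    assume "\<not> ?thesis"
    then have small: "card (nbh G b \<inter> A) \<le> m - 5" if "b \<in> B" for b
      using that by fastforce
    have "card A * (card B - 2) \<le> (\<Sum>a\<in>A. card (B \<inter> nbh G a))"
      using sum_mono[of A "\<lambda>_. card B - 2" "\<lambda>a. card (B \<inter> nbh G a)"] nb by simp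
    also have "\<dots> = (\<Sum>a\<in>A. \<Sum>b\<in>B. if b \<in> nbh G a then 1 else 0)"
      using fin by (intro sum.cong) (simp_all add: sum.If_cases Int_def)
    also have "\<dots> = (\<Sum>b\<in>B. \<Sum>a\<in>A. if b \<in> nbh G a then 1 else 0)"
      by (rule sum.swap)
    also have "\<dots> = (\<Sum>b\<in>B. card (nbh G b \<inter> A))"
      using fin nbh_sym[of _ G]
      by (intro sum.cong) (simp_all add: sum.If_cases Int_def conj_commute)
    also have "\<dots> \<le> card B * (m - 5)"
      using sum_mono[of B "\<lambda>b. card (nbh G b \<inter> A)" "\<lambda>_. m - 5"] small by simp
    finally have le: "card A * (card B - 2) \<le> card B * (m - 5)" .
    obtain q where q: "m = q + 9"
      using m by (metis le_Suc_ex add.commute)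
    \<comment> \<open>As \<open>card A\<close> grows, \<open>card B\<close> shrinks by the same
      amount; in each case the smallest \<open>card A\<close> allowed by
      \<open>m + 2 \<le> n\<close> already contradicts \<open>le\<close>.\<close>
    consider "card A = n - 4" | "card A = n - 3" | "card A = n - 2"
      using A card_A by linarith
    then show False
    proof cases
      case 1
      then have "card B = q + 6" "q + 7 \<le> card A"
        using card_split q mn by auto
      then have "(q + 7) * (q + 4) \<le> (q + 6) * (q + 4)"
        using le q by (intro order_trans[OF mult_le_mono1[of "q + 7" "card A" "q + 4"]]) (simp_all add: add.commute)
      then show False
        by (simp add: algebra_simps)
    next
      case 2
      then have "card B = q + 5" "q + 8 \<le> card A"
        using card_split q mn by auto
      then have "(q + 8) * (q + 3) \<le> (q + 5) * (q + 4)"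
        using le q by (intro order_trans[OF mult_le_mono1[of "q + 8" "card A" "q + 3"]]) (simp_all add: add.commute)
      then show False
        by (simp add: algebra_simps)
    next
      case 3
      then have "card B = q + 4" "q + 9 \<le> card A"
        using card_split q mn by auto
      then have "(q + 9) * (q + 2) \<le> (q + 4) * (q + 4)"
        using le q by (intro order_trans[OF mult_le_mono1[of "q + 9" "card A" "q + 2"]]) (simp_all add: add.commute)
      then show False
        by (simp add: algebra_simps)
    qed
  qed
  then obtain b where b: "b \<in> B" "m - 4 \<le> card (nbh G b \<inter> A)"
    by blast
  have other: "\<exists>y\<in>B. y \<noteq> b \<and> y \<in> nbh G a" if "a \<in> A" for a
  proof -
    have "card {b} < card (B \<inter> nbh G a)"
      using nb[OF that] B by simp
    then show ?thesis
      using ex_in_Diff[of "{b}" "B \<inter> nbh G a"] by auto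
  qed
  have "nbh G b \<inter> A \<noteq> {}"
    using b(2) m by (intro notI) simp
  then obtain a where a: "a \<in> nbh G b \<inter> A"
    by blast
  \<comment> \<open>The end \<open>z\<close> of the path can be chosen outside the neighbours of
    \<open>b\<close> unless \<open>b\<close> is adjacent to all of \<open>A\<close>, and then there
    are leaves to spare.\<close>
  obtain z where z: "z \<in> A" "m - 4 \<le> card (nbh G b \<inter> A - {z})"
  proof (cases "A \<subseteq> nbh G b")
    case True
    then have "nbh G b \<inter> A = A"
      by blast
    moreover have "m - 4 \<le> card (A - {a})"
      by (rule card_Diff_ge) (use A' m in auto)
    ultimately show thesis
      using a that by auto
  next
    case False
    then obtain z where "z \<in> A" "z \<notin> nbh G b"
      by blast
    then show thesis
      using that b by auto
  qed
  obtain b2 where b2: "b2 \<in> B" "b2 \<noteq> b" "b2 \<in> nbh G a"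
    using other a by blast
  obtain y where y: "y \<in> B" "y \<noteq> b" "z \<in> nbh G y"
    using other[OF z(1)] nbh_sym[of z G] by blast
  show ?thesis
    using T_one_T_two_at_hub[OF b _ a, of b2] T_star_at_hub[OF b(1) y(1,2) z(1) y(3) z(2)] b2 B by auto
qed

section \<open>Excluding the larger tree from the complement\<close>

abbreviation H :: "'a graph" where
  "H \<equiv> graph_complement G"

lemma H: "simple_graph H"
  by (rule simple_graph_complement[OF G])

lemma in_verts: "u \<in> A \<Longrightarrow> u \<in> verts G" "u \<in> B \<Longrightarrow> u \<in> verts G"
  using split(4) by auto

lemma H_adj: "a \<in> A \<Longrightarrow> c \<in> A \<union> B \<Longrightarrow> c \<noteq> a \<Longrightarrow> c \<notin> nbh G a \<Longrightarrow> c \<in> nbh H a"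
  by (auto simp: nbh_complement in_verts)

text \<open>\<open>F\<close> holds the three vertices of the larger tree outside its star. In
  \<open>B\<close> they are not adjacent to \<open>v\<close> in \<open>H\<close>; in
  \<open>A\<close> they may cost three leaves. So the set \<open>X\<close> below, where they are
  sought, is \<open>B\<close> if \<open>card A \<le> n - 2\<close> and \<open>A \<union> B\<close>
  otherwise.\<close>

lemma H_leaves:
  assumes "card F \<le> 3" "finite F" "F \<subseteq> B \<or> n - 1 \<le> card A"
  shows "n - 4 \<le> card (nbh H v - F)"
  using assms(3)
proof
  assume "F \<subseteq> B"
  then have "A - F = A"
    using split(3) by auto
  then show ?thesis
    using card_A by (simp add: A_def)
next
  assume "n - 1 \<le> card A"
  then have "n - 4 \<le> card (A - F)"
    by (intro card_Diff_ge) (use assms mn m in auto)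
  then show ?thesis
    by (simp add: A_def)
qed

text \<open>Off \<open>S\<close>, the set \<open>A\<close> is a clique of \<open>G\<close> joined to
  the rest of \<open>B\<close>, as \<open>copies_if_clique\<close> requires; four vertices can be
  spared since \<open>n \<ge> 11\<close>.\<close>

lemma copies_if_cover:
  assumes A: "n - 1 \<le> card A" and S: "finite S" "card S \<le> 4"
    and adj: "\<And>a c. a \<in> A - S \<Longrightarrow> c \<in> A \<union> B - S \<Longrightarrow> c \<noteq> a \<Longrightarrow> c \<in> nbh G a"
  shows "\<forall>T\<in>{T_star m, T_one m, T_two m}. contains_copy G T"
proof (rule copies_if_clique[OF G m])
  show "finite (A - S)" "finite (B - S)" "(A - S) \<inter> (B - S) = {}"
    using fin split by auto
  show "5 \<le> card (A - S)"
    by (rule card_Diff_ge) (use A S m mn in auto)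
  have "m \<le> card (A \<union> B - S)"
    by (rule card_Diff_ge) (use S m mn card_split fin split(3) in \<open>auto simp: card_Un_disjoint\<close>)
  then show "m \<le> card (A - S) + card (B - S)"
    using card_Un_le[of "A - S" "B - S"] by (simp add: Un_Diff)
  show "b \<in> nbh G a" if "a \<in> A - S" "b \<in> (A - S) \<union> (B - S)" "a \<noteq> b" for a b
    using adj that by auto
qed

text \<open>For small \<open>A\<close> the trees are centred in \<open>B\<close>; a large
  \<open>A\<close> is almost complete and has at least \<open>m + 1\<close> vertices.\<close>

lemma copies_if_two_missing:
  assumes X: "X = (if card A \<le> n - 2 then B else A \<union> B)"
    and few: "\<And>a. a \<in> A \<Longrightarrow> card (X - {a} - nbh G a) \<le> 2"
  shows "\<forall>T\<in>{T_star m, T_one m, T_two m}. contains_copy G T"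
proof (cases "card A \<le> n - 2")
  case True
  have "B - nbh G a = X - {a} - nbh G a" if "a \<in> A" for a
    using that True X split(3) by auto
  then show ?thesis
    using few True by (intro copies_if_few_missing) auto
next
  case False
  have "card (A - {a} - nbh G a) \<le> 2" if "a \<in> A" for a
  proof -
    have "card (A - {a} - nbh G a) \<le> card (X - {a} - nbh G a)"
      by (rule card_mono) (use X False fin in auto)
    then show ?thesis
      using few[OF that] by linarith
  qed
  then show ?thesis
    using False mn by (intro copies_if_almost_complete[OF G m fin(1)]) auto
qed

text \<open>Three disjoint edges of \<open>H\<close> from \<open>A\<close> into \<open>X\<close>
  would complete \<open>T_tprime n\<close> at the centre \<open>v\<close>. So a set
  \<open>P \<union> Q\<close> of at most four vertices covers these edges, which are the pairs in
  \<open>R\<close>.\<close>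

lemma copies_if_no_T_tprime:
  assumes no: "\<not> contains_copy H (T_tprime n)"
    and max: "\<And>u. u \<in> verts G \<Longrightarrow> card (nbh H u) \<le> card A"
  shows "\<forall>T\<in>{T_star m, T_one m, T_two m}. contains_copy G T"
proof -
  define X where X: "X = (if card A \<le> n - 2 then B else A \<union> B)"
  have XAB: "X \<subseteq> A \<union> B" "v \<notin> X"
    using X split by auto
  define R where "R = {(a, c). a \<in> A \<and> c \<in> X \<and> c \<noteq> a \<and> c \<notin> nbh G a}"
  have three: False if R: "(a1, c1) \<in> R" "(a2, c2) \<in> R" "(a3, c3) \<in> R"
    and disj: "{a2, c2} \<inter> {a1, c1} = {}" "{a3, c3} \<inter> {a1, c1, a2, c2} = {}" for a1 c1 a2 c2 a3 c3
  proof -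
    have "n - 4 \<le> card (nbh H v - {c1, c2, c3})"
      by (rule H_leaves) (use R X in \<open>auto simp: R_def card_triple_le split: if_splits\<close>)
    moreover have "c1 \<in> nbh H a1" "c2 \<in> nbh H a2" "c3 \<in> nbh H a3"
      using R XAB by (auto simp: R_def intro!: H_adj)
    moreover have "c1 \<noteq> v" "c2 \<noteq> v" "c3 \<noteq> v" "a1 \<in> nbh H v" "a2 \<in> nbh H v" "a3 \<in> nbh H v"
      using R XAB by (auto simp: R_def A_def)
    ultimately show False
      using copy_T_tprime[OF H, of n a1 v a2 a3 c1 c2 c3] no disj m mn by auto
  qed
  obtain P Q where PQ: "P \<subseteq> Domain R" "Q \<subseteq> Range R" "finite P" "finite Q" "card P \<le> 2" "card Q \<le> 2"
    and cover: "\<And>a c. (a, c) \<in> R \<Longrightarrow> a \<in> P \<union> Q \<or> c \<in> P \<union> Q"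
    using no_three_disjoint_pairs[of R] three by metis
  have PQ': "P \<subseteq> A" "Q \<subseteq> X"
    using PQ by (auto simp: R_def)
  have adj: "c \<in> nbh G a" if "a \<in> A - (P \<union> Q)" "c \<in> X - (P \<union> Q)" "c \<noteq> a" for a c
    using cover[of a c] that by (auto simp: R_def)
  show ?thesis
  proof (cases "card A \<le> n - 2")
    case False
    moreover have "card (P \<union> Q) \<le> 4"
      using card_Un_le[of P Q] PQ by linarith
    ultimately show ?thesis
      using adj X PQ by (intro copies_if_cover[of "P \<union> Q"]) auto
  next
    case True
    then have XB: "X = B"
      using X by simp
    then have QB: "Q \<subseteq> B" "A \<inter> Q = {}" "B \<inter> P = {}"
      using PQ' split(3) by auto
    have bip: "a \<in> nbh G b" if "a \<in> A - P" "b \<in> B - Q" for a b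
      using adj[of a b] that XB QB split(3) nbh_sym[of a G b] by auto
    have B: "4 \<le> card B"
      using True card_split m mn by linarith
    have BQ2: "2 \<le> card (B - Q)"
      by (rule card_Diff_ge) (use PQ B in auto)
    show ?thesis
    proof (cases "m - 3 \<le> card (A - P)")
      case True
      then show ?thesis
        using copies_if_complete_bipartite[of "A - P" "B - Q"] bip BQ2 B by auto
    next
      case False
      have cardAP: "card (A - P) = card A - card P" "card P \<le> card A"
        using PQ' PQ fin by (auto simp: card_Diff_subset card_mono)
      have "card A \<le> m - 2"
        using False cardAP(1) PQ(5) by linarith
      then have eqsA: "card A = m - 2" "n = m + 2"
        using card_A mn m by auto
      have eqsP: "card P = 2" "card (A - P) = m - 4"
        using False cardAP PQ(5) eqsA(1) by linarith+
      have "card B = m - 3"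
        using card_split eqsA m by linarith
      note eqs = eqsA eqsP this
      have BQ4: "4 \<le> card (B - Q)"
        by (rule card_Diff_ge) (use PQ eqs m in auto)
      \<comment> \<open>The only tight case; \<open>A\<close> loses two vertices to the cover and \<open>n = m + 2\<close>. If both of them
        are isolated from \<open>B\<close> in \<open>G\<close>, then the minimum degree of \<open>G\<close> joins one of them to
        \<open>A - P\<close>, and a vertex of \<open>A - P\<close> can serve as the centre with all of \<open>B\<close> as leaves.\<close>
      obtain p q where P: "P = {p, q}" "p \<noteq> q"
        using eqs(3) by (meson card_2_iff)
      show ?thesis
      proof (cases "\<exists>z\<in>P. \<exists>y\<in>B. z \<in> nbh G y")
        case True
        then obtain z y where zy: "z \<in> P" "y \<in> B" "z \<in> nbh G y"
          by blast
        obtain b where b: "b \<in> B - Q" "b \<noteq> y"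
          using ex_in_Diff[of "{y}" "B - Q"] BQ4 by auto
        obtain b2 where b2: "b2 \<in> B - Q" "b2 \<noteq> b"
          using ex_in_Diff[of "{b}" "B - Q"] BQ4 by auto
        \<comment> \<open>Since \<open>z\<close> lies in \<open>P\<close>, ending the path there
          takes none of the \<open>m - 4\<close> leaves in \<open>A - P\<close>.\<close>
        have sub: "A - P \<subseteq> nbh G b \<inter> A - {z}"
          using bip b zy by auto
        have star: "m - 4 \<le> card (nbh G b \<inter> A - {z})"
          using card_mono[OF _ sub] fin eqs by simp
        also have "\<dots> \<le> card (nbh G b \<inter> A)"
          by (rule card_mono) (use fin in auto)
        finally have hub: "m - 4 \<le> card (nbh G b \<inter> A)" .
        obtain a where a: "a \<in> A - P"
          using ex_in_Diff[of "{}" "A - P"] eqs(4) m by auto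
        have "b2 \<in> nbh G a" "a \<in> nbh G b"
          using bip a b b2 nbh_sym[of b2 G a] by auto
        then show ?thesis
          using T_one_T_two_at_hub[of b a b2] T_star_at_hub[of b y z] hub star a b b2 zy B PQ' by auto
      next
        case False
        then have nP: "y \<notin> nbh G z" if "z \<in> P" "y \<in> B" for z y
          using that nbh_sym[of z G y] by auto
        obtain b b2 where b: "b \<in> B - Q" "b2 \<in> B - Q" "b2 \<noteq> b"
          using ex_in_Diff[of "{}" "B - Q"] ex_in_Diff[of "{b}" "B - Q" for b] BQ4 by fastforce
        \<comment> \<open>A non-adjacent \<open>y\<close> would lie in \<open>Q\<close>, and
          \<open>(p, b)\<close>, \<open>(q, b2)\<close>, \<open>(a, y)\<close> would be three
          disjoint pairs in \<open>R\<close>.\<close>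
        have full: "y \<in> nbh G a" if a: "a \<in> A - P" and y: "y \<in> B" for a y
        proof (rule ccontr)
          assume nadj: "y \<notin> nbh G a"
          then have "y \<in> Q"
            using bip[of a y] nbh_sym[of a G y] a y by auto
          then show False
            using three[of p b q b2 a y] P nP b a y nadj XB PQ' split(3) by (auto simp: R_def)
        qed
        have "p \<in> A"
          using P PQ' by auto
        \<comment> \<open>Maximum degree of \<open>v\<close> in \<open>H\<close> is minimum degree
          in \<open>G\<close>. As \<open>p\<close> is adjacent neither to \<open>v\<close> nor to
          \<open>B\<close>, some neighbour \<open>y\<close> lies in \<open>A - P\<close>.\<close>
        then have "card B \<le> card (nbh G p)"
          using max[OF in_verts(1)] card_nbh_complement[OF G in_verts(1)] card_nbh_complement[OF G v]
          by (fastforce simp: A_def B_def)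
        then have "card {p, q} < card (nbh G p)"
          using eqs m card_doubleton_le[of p q] by linarith
        then obtain y where y: "y \<in> nbh G p" "y \<notin> P"
          using ex_in_Diff[of "{p, q}" "nbh G p"] P by auto
        have "p \<notin> nbh G v"
          using \<open>p \<in> A\<close> split(3) by (auto simp: B_def)
        then have "y \<noteq> v"
          using y(1) nbh_sym[of p G v] by auto
        moreover have "y \<in> insert v (A \<union> B)"
          using nbh_verts(1)[OF G y(1)] split(4) by simp
        ultimately have "y \<in> A - P"
          using y nP[of p y] P by auto
        have "card {y} < card (A - P)"
          using eqs(4) m by simp
        then obtain c where c: "c \<in> A - P" "c \<noteq> y"
          using ex_in_Diff[of "{y}" "A - P"] by auto
        have nb: "x \<in> nbh G a" "a \<in> nbh G x" if "a \<in> A - P" "x \<in> B" for a x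
          using full[OF that] nbh_sym[of x G a] by auto
        \<comment> \<open>The path is \<open>c\<close>, \<open>b\<close>, \<open>y\<close>,
          \<open>p\<close>; its last two vertices lie in \<open>A\<close>, so all
          \<open>m - 3\<close> vertices of \<open>B\<close> stay neighbours of the centre.\<close>
        have "B \<subseteq> nbh G c - {y, p}"
          using nb[OF c(1)] \<open>y \<in> A - P\<close> \<open>p \<in> A\<close> split(3) by auto
        then have "card B \<le> card (nbh G c - {y, p})"
          by (intro card_mono) (auto simp: finite_nbh[OF G])
        then have "contains_copy G (T_star m)"
          using copy_T_star[OF G, of m b c y p] nb[OF c(1), of b] nb[OF \<open>y \<in> A - P\<close>, of b] y b c P
            eqs m \<open>p \<in> A\<close> split(3) nbh_sym[of y G p] by auto
        moreover have "m - 4 \<le> card (nbh G b \<inter> A)"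
          using card_mono[of "nbh G b \<inter> A" "A - P"] nb b fin eqs by auto
        ultimately show ?thesis
          using T_one_T_two_at_hub[of b c b2] nb[OF c(1), of b] nb[OF c(1), of b2] b c B by auto
      qed
    qed
  qed
qed

text \<open>If \<open>a1\<close> has two \<open>H\<close>-neighbours \<open>c1\<close>,
  \<open>c2\<close> in \<open>X\<close>, any edge of \<open>H\<close> from \<open>A\<close> into
  \<open>X\<close> disjoint from these three vertices completes \<open>T_dprime n\<close> at
  \<open>v\<close>; so the three form a cover. Otherwise every vertex of \<open>A\<close> misses at
  most one vertex of \<open>X\<close>.\<close>

lemma copies_if_no_T_dprime:
  assumes no: "\<not> contains_copy H (T_dprime n)"
  shows "\<forall>T\<in>{T_star m, T_one m, T_two m}. contains_copy G T"
proof -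
  define X where X: "X = (if card A \<le> n - 2 then B else A \<union> B)"
  have XAB: "X \<subseteq> A \<union> B" "v \<notin> X"
    using X split by auto
  show ?thesis
  proof (cases "\<exists>a1\<in>A. \<exists>c1\<in>X - {a1} - nbh G a1. \<exists>c2\<in>X - {a1} - nbh G a1. c1 \<noteq> c2")
    case True
    then obtain a1 c1 c2 where a1: "a1 \<in> A" "c1 \<in> X - {a1} - nbh G a1" "c2 \<in> X - {a1} - nbh G a1"
      "c1 \<noteq> c2"
      by blast
    let ?S = "{a1, c1, c2}"
    have adj: "c \<in> nbh G a" if a: "a \<in> A - ?S" and c: "c \<in> X - ?S" "c \<noteq> a" for a c
    proof (rule ccontr)
      assume nadj: "c \<notin> nbh G a"
      have "n - 4 \<le> card (nbh H v - {c1, c2, c})"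
        by (rule H_leaves) (use a1 c X in \<open>auto simp: card_triple_le split: if_splits\<close>)
      moreover have "c1 \<in> nbh H a1" "c2 \<in> nbh H a1" "c \<in> nbh H a"
        using a1 a c nadj XAB by (auto intro!: H_adj)
      ultimately show False
        using copy_T_dprime[OF H, of n a1 v a c1 c2 c] no a1 a c XAB m mn
        by (auto simp: A_def)
    qed
    show ?thesis
    proof (cases "card A \<le> n - 2")
      case True
      then have XB: "X = B"
        using X by simp
      show ?thesis
      \<comment> \<open>The cover meets \<open>A\<close> in \<open>a1\<close> alone, so at least
        \<open>n - 5 \<ge> m - 3\<close> vertices are left and no tight case arises.\<close>
      proof (rule copies_if_complete_bipartite[of "A - {a1}" "B - {c1, c2}"])
        show "a \<in> nbh G b" if "a \<in> A - {a1}" "b \<in> B - {c1, c2}" for a b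
          using adj[of a b] that XB a1 split(3) nbh_sym[of a G b] by auto
        show "m - 3 \<le> card (A - {a1})"
          by (rule card_Diff_ge) (use card_A m mn in auto)
        show "2 \<le> card (B - {c1, c2})"
          by (rule card_Diff_ge) (use True card_split card_doubleton_le[of c1 c2] m mn in auto)
        show "3 \<le> card B"
          using True card_split m mn by linarith
      qed auto
    next
      case False
      then show ?thesis
        using adj X by (intro copies_if_cover[of ?S]) (auto simp: card_triple_le[THEN order_trans])
    qed
  next
    case False
    have "card (X - {a} - nbh G a) \<le> 2" if "a \<in> A" for a
    proof (rule ccontr)
      assume "\<not> card (X - {a} - nbh G a) \<le> 2"
      then have "2 \<le> card (X - {a} - nbh G a)"
        by linarith
      then obtain ys where ys: "distinct ys" "set ys \<subseteq> X - {a} - nbh G a" "length ys = 2"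
        by (rule obtain_list_of_length)
      then obtain y1 y2 where "ys = [y1, y2]"
        by (auto simp: numeral_eq_Suc length_Suc_conv)
      then show False
        using ys that False by auto
    qed
    then show ?thesis
      by (rule copies_if_two_missing[OF X])
  qed
qed

text \<open>Three \<open>H\<close>-neighbours in \<open>X\<close> of one \<open>a\<close> in
  \<open>A\<close> would make \<open>a\<close> the second branching vertex of
  \<open>T_three n\<close>.\<close>

lemma copies_if_no_T_three:
  assumes no: "\<not> contains_copy H (T_three n)"
  shows "\<forall>T\<in>{T_star m, T_one m, T_two m}. contains_copy G T"
proof (rule copies_if_two_missing[OF refl], rule ccontr)
  let ?X = "if card A \<le> n - 2 then B else A \<union> B"
  fix a assume a: "a \<in> A" and "\<not> card (?X - {a} - nbh G a) \<le> 2"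
  then have "3 \<le> card (?X - {a} - nbh G a)"
    by linarith
  then obtain ys where ys: "distinct ys" "set ys \<subseteq> ?X - {a} - nbh G a" "length ys = 3"
    by (rule obtain_list_of_length)
  then obtain y1 y2 y3 where eq: "ys = [y1, y2, y3]"
    by (auto simp: numeral_eq_Suc length_Suc_conv)
  have "n - 4 \<le> card (nbh H v - {y1, y2, y3})"
    by (rule H_leaves) (use ys eq in \<open>auto simp: card_triple_le split: if_splits\<close>)
  moreover have "y \<in> nbh H a" "y \<noteq> v" if "y \<in> {y1, y2, y3}" for y
    using that ys eq H_adj[OF a, of y] split by (auto split: if_splits)
  ultimately show False
    using copy_T_three[OF H, of n a v y1 y2 y3] no a ys eq m mn by (auto simp: A_def)
qed

end

section \<open>Assembling the upper and lower bounds\<close>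

lemma ramsey_upper:
  assumes G: "simple_graph G" and card: "card (verts G) = m + n - 6"
    and m: "9 \<le> m" and mn: "m + 2 \<le> n" and ndvd: "\<not> (m - 1) dvd (n - 5)"
    and Tm: "Tm \<in> {T_star m, T_one m, T_two m}"
    and Tn: "Tn \<in> {T_dprime n, T_tprime n, T_three n}"
  shows "contains_copy G Tm \<or> contains_copy (graph_complement G) Tn"
proof (rule ccontr)
  let ?H = "graph_complement G"
  assume "\<not> ?thesis"
  then have noG: "\<not> (\<forall>T\<in>{T_star m, T_one m, T_two m}. contains_copy G T)"
    and noH: "\<not> contains_copy ?H Tn"
    using Tm by blast+
  have fin: "finite (verts G)"
    using G by (simp add: simple_graph_def)
  have low: "card (nbh ?H v) \<le> n - 5" if v: "v \<in> verts G" for v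
  proof (rule ccontr)
    assume big: "\<not> card (nbh ?H v) \<le> n - 5"
    \<comment> \<open>The degree is taken maximal, not just large, because
      \<open>copies_if_no_T_tprime\<close> relies on it.\<close>
    let ?D = "(\<lambda>u. card (nbh ?H u)) ` verts G"
    have "Max ?D \<in> ?D"
      using fin v by (intro Max_in) auto
    then obtain w where w: "w \<in> verts G" "card (nbh ?H w) = Max ?D"
      by auto
    then have max: "card (nbh ?H u) \<le> card (nbh ?H w)" if "u \<in> verts G" for u
      using that fin by auto
    then have "n - 4 \<le> card (nbh ?H w)"
      using max[OF v] big by linarith
    then have split: "split_at_vertex G w m n (nbh ?H w) (nbh G w)"
      by unfold_locales (use G card m mn w in auto)
    show False
      using split_at_vertex.copies_if_no_T_dprime[OF split] split_at_vertex.copies_if_no_T_three[OF split]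
        split_at_vertex.copies_if_no_T_tprime[OF split _ max] noG noH Tn by blast
  qed
  have deg: "m - 2 \<le> card (nbh G v)" if "v \<in> verts G" for v
    using low[OF that] card_nbh_complement[OF G that] card m mn by linarith
  have "(m - 1) dvd (m + n - 6)"
    using dvd_card_verts_if_min_degree[OF G m deg noG] card by simp
  moreover have "m + n - 6 = (m - 1) + (n - 5)"
    using m mn by simp
  ultimately show False
    using ndvd by simp
qed

theorem theorem6p1:
  fixes m n :: nat and Tm Tn :: "nat graph"
  assumes "n \<ge> 15" and "m \<ge> 9"
    and "\<not> (m - 1) dvd (n - 5)"
    and "real n > real m + 1 + 12 / (real m - 8)"
    and "Tm \<in> {T_star m, T_one m, T_two m}"
    and "Tn \<in> {T_dprime n, T_tprime n, T_three n}"
  shows "ramsey_number Tm Tn \<in> {m + n - 7, m + n - 6} \<and>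
    (n \<ge> (m - 3)^2 + 4 \<or> (\<exists>x y :: nat. m + n - 7 = (m - 1) * x + (m - 2) * y)
      \<longrightarrow> ramsey_number Tm Tn = m + n - 6)"
proof -
  note m = assms(2) and Tm = assms(5) and Tn = assms(6)
  have "0 \<le> 12 / (real m - 8)"
    using m by simp
  then have "real m + 1 < real n"
    using assms(4) by linarith
  then have mn: "m + 2 \<le> n"
    by linarith
  have upper: "contains_copy G Tm \<or> contains_copy (graph_complement G) Tn"
    if "simple_graph G" "card (verts G) = m + n - 6" for G :: "nat graph"
    using ramsey_upper[OF that m mn assms(3) Tm Tn] .
  then have le: "ramsey_number Tm Tn \<le> m + n - 6"
    unfolding ramsey_number_def using m mn by (intro Least_le) auto
  have less: "p < ramsey_number Tm Tn" if "realizable m d p" "p \<le> d + n - 4" for d p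
    by (rule less_ramsey_number[OF that _ _ Tm Tn _ upper]) (use m mn in auto)
  have "realizable m (m - 4) (m + n - 8)"
    by (rule realizable_near_regular[OF m mn])
  then have ge: "m + n - 7 \<le> ramsey_number Tm Tn"
    using less[of "m - 4" "m + n - 8"] m mn by simp
  have "ramsey_number Tm Tn = m + n - 6" if xy: "m + n - 7 = (m - 1) * x + (m - 2) * y" for x y
  proof -
    \<comment> \<open>The cliques have degrees at least \<open>m - 3\<close>, one more than the
      near-regular witness guarantees, which allows one more vertex.\<close>
    have "realizable m (m - 3) (m + n - 7)"
      unfolding xy
      by (intro realizable_add realizable_mult; rule realizable_clique) (use m in auto)
    then show ?thesis
      using less[of "m - 3" "m + n - 7"] m mn le by simp
  qed
  moreover have "\<exists>x y. m + n - 7 = (m - 1) * x + (m - 2) * y" if n: "n \<ge> (m - 3)^2 + 4"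
  proof -
    \<comment> \<open>This is the threshold of \<open>ex_consecutive_combination\<close> for
      \<open>j = m - 3\<close>, where the block sizes are \<open>m - 1\<close> and
      \<open>m - 2\<close>.\<close>
    have "(m - 3) * (m - 3 + 1) = (m - 3)^2 + (m - 3)"
      by (simp add: power2_eq_square)
    also have "\<dots> \<le> m + n - 7"
      using n m by simp
    finally have "(m - 3) * (m - 3 + 1) \<le> m + n - 7" .
    moreover have "m - 3 + 1 = m - 2" "m - 3 + 2 = m - 1"
      using m by simp_all
    ultimately show ?thesis
      using ex_consecutive_combination[of "m - 3" "m + n - 7"] by metis
  qed
  moreover have "ramsey_number Tm Tn \<in> {m + n - 7, m + n - 6}"
    using le ge m by auto
  ultimately show ?thesis
    by blast
qed

end
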